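(* Let $N\ge1$ and let $p\ge1$ be an integer. Let $(f_n)_{n\in\mathbb N}$ be a sequence in $\mathfrak{LC}_p(\mathbb R^{2N},\mathbb R^N)$ converging to $f$ in $(\mathfrak{LC}_p(\mathbb R^{2N},\mathbb R^N),\mathcal T_B)$ and let $(\phi_n)_{n\in\mathbb N}$ be a sequence in $\mathcal C=C([-1,0],\mathbb R^N)$ converging uniformly to $\phi\in\mathcal C$. Then $$x(\cdot,f_n,\phi_n)\xrightarrow{n\to\infty}x(\cdot,f,\phi)$$ uniformly in any $[-1,T]\subset I_{f,\phi}$.
   Context: $B_j$ is the closed ball of radius $j$ centered at the origin; $C(I,W)$ is the space of continuous functions $I\to W$. $L^p_{loc}$ is the set of real functions on $\mathbb R$ belonging to $L^p(I)$ for every compact interval $I$. $\mathfrak{LC}_p(\mathbb R^{2N},\mathbb R^N)$ is the set of functions $f:\mathbb R\times\mathbb R^{2N}\to\mathbb R^N$ such that: $f$ is Borel measurable; for every compact $K\subset\mathbb R^{2N}$ there are $m^K,l^K\in L^p_{loc}$ such that for a.e. $t\in\mathbb R$, $|f(t,z)|\le m^K(t)$ and $|f(t,z_1)-f(t,z_2)|\le l^K(t)|z_1-z_2|$ for all $z,z_1,z_2\in K$. Functions differing only on a negligible set are identified. $\mathcal T_B$ is the topology generated by the seminorms $p_{I,j}(f)=\sup_{z(\cdot)\in C(I,B_j)}\left[\int_I|f(t,z(t))|^pdt\right]^{1/p}$, $B_j\subset\mathbb R^{2N}$, $I=[q_1,q_2]$, $q_1,q_2\in\mathbb Q$, $j\in\mathbb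 N$. For $f\in\mathfrak{LC}_p(\mathbb R^{2N},\mathbb R^N)$ and $\phi\in\mathcal C$, $x(\cdot,f,\phi)$ denotes the unique maximal continuous (Carathéodory) solution, with maximal interval of definition $I_{f,\phi}=[-1,b_{f,\phi})$, of $\dot x=f(t,x(t),x(t-1))$ for $t>0$, $x(t)=\phi(t)$ for $t\in[-1,0]$; if $b_{f,\phi}<\infty$ then $|x(t,f,\phi)|\to\infty$ as $t\to b_{f,\phi}$. Convergence on $[-1,T]$ is understood for $n$ large enough that $[-1,T]\subset I_{f_n,\phi_n}$, this being part of the assertion. *)

theory Defs
  imports "HOL-Analysis.Analysis"
begin

text \<open>
  Functions of $(t,z)$ are curried. The space $R^{2N}$ is rendered as
  \<^typ>\<open>(real ^ 'n) \<times> (real ^ 'n)\<close>, whose norm is the Euclidean one.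
\<close>

definition Lp_loc :: "nat \<Rightarrow> (real \<Rightarrow> real) set" where
  "Lp_loc p = {m. \<forall>a b. m \<in> borel_measurable (lebesgue_on {a..b}) \<and>
                        integrable (lebesgue_on {a..b}) (\<lambda>t. \<bar>m t\<bar> ^ p)}"

text \<open>
  The elements below are representatives: no quotient by equality outside a negligible set is
  taken. For members of this set, being Lipschitz in $z$ for almost every $t$, equality almost
  everywhere in $(t,z)$ means that for almost every $t$ they agree for all $z$. Equivalent
  representatives therefore have the same seminorms and the same solutions.
\<close>

definition LC ::
  "nat \<Rightarrow> (real \<Rightarrow> 'z::euclidean_space \<Rightarrow> 'w::euclidean_space) set" where
  "LC p = {f. (\<lambda>(t, z). f t z) \<in> borel_measurable borel \<and>
     (\<forall>K. compact K \<longrightarrow>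
       (\<exists>m\<in>Lp_loc p. \<exists>l\<in>Lp_loc p. AE t in lborel.
          (\<forall>z\<in>K. norm (f t z) \<le> m t) \<and>
          (\<forall>z1\<in>K. \<forall>z2\<in>K. norm (f t z1 - f t z2) \<le> l t * norm (z1 - z2))))}"

text \<open>
  The supremum and the integral are real-valued. On \<^term>\<open>LC p\<close> the integrand is
  dominated by the $p$-th power of the function $m$ attached to the ball, so both are the
  usual finite ones.
\<close>

definition TB_seminorm ::
  "nat \<Rightarrow> real \<Rightarrow> real \<Rightarrow> nat \<Rightarrow>
   (real \<Rightarrow> 'z::euclidean_space \<Rightarrow> 'w::euclidean_space) \<Rightarrow> real" where
  "TB_seminorm p q1 q2 j f =
     (SUP z \<in> {z. continuous_on {q1..q2} z \<and> z ` {q1..q2} \<subseteq> cball 0 (real j)}.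
        root p (set_lebesgue_integral lborel {q1..q2} (\<lambda>t. norm (f t (z t)) ^ p)))"

definition TB :: "nat \<Rightarrow> (real \<Rightarrow> 'z::euclidean_space \<Rightarrow> 'w::euclidean_space) topology" where
  "TB p = topology_generated_by
     {{g \<in> LC p. TB_seminorm p q1 q2 j (\<lambda>t z. g t z - f t z) < \<epsilon>} | f q1 q2 j \<epsilon>.
        f \<in> LC p \<and> q1 \<in> \<rat> \<and> q2 \<in> \<rat> \<and> q1 \<le> q2 \<and> 0 < \<epsilon>}"

text \<open>
  Absolute continuity on a compact interval: a pair $(u,v)$ in $D$ stands for the
  interval $[u,v]$, and distinct members of $D$ do not overlap.
\<close>

definition abs_cont_on :: "real \<Rightarrow> real \<Rightarrow> (real \<Rightarrow> 'a::real_normed_vector) \<Rightarrow> bool" where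
  "abs_cont_on a b x \<longleftrightarrow>
     (\<forall>\<epsilon>>0. \<exists>\<delta>>0. \<forall>D. finite D \<longrightarrow>
        (\<forall>(u, v)\<in>D. a \<le> u \<and> u \<le> v \<and> v \<le> b) \<longrightarrow>
        disjoint_family_on (\<lambda>(u, v). {u<..<v}) D \<longrightarrow>
        (\<Sum>(u, v)\<in>D. v - u) < \<delta> \<longrightarrow>
        (\<Sum>(u, v)\<in>D. norm (x v - x u)) < \<epsilon>)"

text \<open>
  Caratheodory solutions on $[-1,b)$ with $0 < b \le \infty$. Values of \<^term>\<open>x\<close> outside
  $[-1,b)$ are irrelevant.
\<close>

definition delay_solution ::
  "(real \<Rightarrow> 'a \<times> 'a \<Rightarrow> 'a::euclidean_space) \<Rightarrow> (real \<Rightarrow> 'a) \<Rightarrow> ereal \<Rightarrow> (real \<Rightarrow> 'a) \<Rightarrow> bool" where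
  "delay_solution f \<phi> b x \<longleftrightarrow>
     0 < b \<and>
     continuous_on {t. -1 \<le> t \<and> ereal t < b} x \<and>
     (\<forall>t\<in>{-1..0}. x t = \<phi> t) \<and>
     (\<forall>T\<ge>0. ereal T < b \<longrightarrow> abs_cont_on 0 T x) \<and>
     (AE t in lborel. 0 < t \<and> ereal t < b \<longrightarrow>
        (x has_vector_derivative f t (x t, x (t - 1))) (at t))"

definition maximal_delay_solution ::
  "(real \<Rightarrow> 'a \<times> 'a \<Rightarrow> 'a::euclidean_space) \<Rightarrow> (real \<Rightarrow> 'a) \<Rightarrow> ereal \<Rightarrow> (real \<Rightarrow> 'a) \<Rightarrow> bool" where
  "maximal_delay_solution f \<phi> b x \<longleftrightarrow>
     delay_solution f \<phi> b x \<and>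
     \<not> (\<exists>c y. b < c \<and> delay_solution f \<phi> c y \<and>
             (\<forall>t. -1 \<le> t \<and> ereal t < b \<longrightarrow> y t = x t))"

end

theory Submission
  imports Defs
begin

text \<open>
  Subtracting the integral equations of \<open>x\<^sub>n\<close> and \<open>x\<close> and writing
  \<open>z\<^sub>n(t) = (x\<^sub>n(t), x\<^sub>n(t - 1))\<close>, the difference of the right-hand sides is
  \<open>[f\<^sub>n(t, z\<^sub>n) - f(t, z\<^sub>n)] + [f(t, z\<^sub>n) - f(t, z)]\<close>. As long as \<open>x\<^sub>n\<close> stays within distance 1
  of \<open>x\<close>, the curve \<open>z\<^sub>n\<close> lies in a fixed ball, so the integral of the first bracket is small
  because the seminorms take a supremum over all continuous curves in that ball; no compactness of
  the family \<open>z\<^sub>n\<close> is needed. The second bracket is controlled by the Lipschitz function of \<open>f\<close>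
  and a Gronwall argument. Hence \<open>x\<^sub>n\<close> never leaves the tube around \<open>x\<close>, and since a bounded
  solution on a finite interval can be continued, it exists beyond \<open>T\<close>.
\<close>

section \<open>Differentiation and absolute continuity on the line\<close>

text \<open>The estimate is circular as it stands: a seminorm controls \<open>fs n - f\<close> along
  a curve only inside a given ball, and staying in that ball is part of the claim. The circle is
  broken at the first time the distance to \<open>x\<close> reaches 1, where the estimate returns a
  bound strictly below 1. The radius, the Lipschitz function and the number of doublings in the
  Gronwall step must come from \<open>f\<close> and \<open>x\<close> alone. Convergence in
  \<open>TB p\<close> gives no Lipschitz bound uniform in \<open>n\<close>: (1/n) sin(n^2 z) tends
  to 0 while its Lipschitz constants grow. This is why the difference is split at
  \<open>f(t, z_n)\<close> and not at \<open>f_n(t, z)\<close>. The bounds attached to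
  \<open>fs n\<close> serve only for each \<open>n\<close> separately, in integrability and
  continuation. Solutions are defined by absolute continuity and a derivative almost everywhere,
  whereas all estimates concern integrals. Given solutions are turned into integral equations, and
  the continued function is turned back into a \<open>delay_solution\<close>, because maximality
  speaks of those; so both directions of the fundamental theorem for the Lebesgue integral are
  required.\<close>

lemma AE_lborel_iff_negligible: "(AE x in lborel. P x) \<longleftrightarrow> negligible {x. \<not> P x}"
  by (metis AE_completion_iff eventually_ae_filter_negligible negligible_subset order_refl)

text \<open>
  At a bad point there are arbitrarily short intervals on which the increment of the primitive is
  off by a fixed fraction of the length. By Vitali, disjoint ones cover the bad set up to a
  null set, while Henstock's lemma bounds their total length.
\<close>

lemma lebesgue_differentiation:
  fixes f :: "real \<Rightarrow> 'a::euclidean_space"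
  assumes f: "f integrable_on {a..b}"
  shows "negligible {t \<in> {a<..<b}. \<not> ((\<lambda>u. integral {a..u} f) has_vector_derivative f t) (at t)}"
proof -
  define F where "F u = integral {a..u} f" for u
  define R where "R t y = norm (F y - F t - (y - t) *\<^sub>R f t)" for t y
  \<comment> \<open>Failure of the derivative at \<open>t\<close> means that some fixed fraction of
    the length is exceeded at arbitrarily small scales. Restricting the fractions to
    \<open>1 / Suc k\<close> makes the bad set a countable union, so one \<open>k\<close> can be
    treated at a time.\<close>
  define E where "E k = {t \<in> {a<..<b}. \<forall>d>0. \<exists>y\<in>{a<..<b}. \<bar>y - t\<bar> < d \<and> R t y > \<bar>y - t\<bar> / Suc k}" for k
  have F_diff: "F y - F t = integral {t..y} f" if "a \<le> t" "t \<le> y" "y \<le> b" for t y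
    using Henstock_Kurzweil_Integration.integral_combine[of a t y f] that
      integrable_on_subinterval[OF f, of a y] by (auto simp: F_def algebra_simps)
  have R_eq: "R t y = norm (measure lborel {min t y..max t y} *\<^sub>R f t - integral {min t y..max t y} f)"
    if "t \<in> {a<..<b}" "y \<in> {a<..<b}" for t y
  proof (cases "t \<le> y")
    case True
    then show ?thesis using F_diff[of t y] that
      by (simp add: R_def norm_minus_commute)
  next
    case False
    have "F y - F t - (y - t) *\<^sub>R f t = measure lborel {y..t} *\<^sub>R f t - integral {y..t} f"
      using F_diff[of y t] False that by (simp add: algebra_simps)
    then show ?thesis using False by (simp add: R_def)
  qed
  have neg: "negligible (E k)" for k
    unfolding negligible_outer_le
  proof (intro allI impI)
    fix e :: real assume e: "0 < e"
    \<comment> \<open>Henstock's lemma bounds the total error by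
      \<open>2 * DIM('a) * \<eta>\<close>, and each chosen interval is shorter than
      \<open>Suc k\<close> times its error, so the total length comes out as exactly
      \<open>e\<close>.\<close>
    define \<eta> where "\<eta> = e / (2 * real DIM('a) * real (Suc k))"
    have \<eta>: "\<eta> > 0" unfolding \<eta>_def using e by (intro divide_pos_pos mult_pos_pos) (auto simp del: of_nat_Suc)
    obtain \<gamma> where \<gamma>: "gauge \<gamma>" and \<gamma>_less: "\<And>p. p tagged_division_of {a..b} \<Longrightarrow> \<gamma> fine p \<Longrightarrow>
       norm ((\<Sum>(x,K)\<in>p. measure lborel K *\<^sub>R f x) - integral {a..b} f) < \<eta>"
      using integrable_integral[OF f, unfolded has_integral_real, rule_format, OF \<eta>] by meson
    define J where "J = (\<lambda>(t, y). {min t y..max t y::real})"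
    define I where "I = {(t, y). t \<in> {a<..<b} \<and> y \<in> {a<..<b} \<and> J (t, y) \<subseteq> \<gamma> t \<and> R t y > \<bar>y - t\<bar> / Suc k}"
    \<comment> \<open>In a pair \<open>(t, y)\<close> the tag \<open>t\<close> is an endpoint of the
      interval. Midpoint \<open>c\<close> and half-length \<open>r\<close> present the same interval
      as a ball for the Vitali theorem, which only asks that the covered point lie in the ball, not
      at its centre.\<close>
    define c where "c = (\<lambda>(t, y). (t + y) / 2 :: real)"
    define r where "r = (\<lambda>(t, y). \<bar>y - t\<bar> / 2 :: real)"
    have J_cball: "cball (c i) (r i) = J i" for i
    proof (cases i)
      case (Pair t y)
      have "(t + y) / 2 - \<bar>y - t\<bar> / 2 = min t y" "(t + y) / 2 + \<bar>y - t\<bar> / 2 = max t y"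
        by (simp_all add: min_def max_def abs_if field_simps)
      then show ?thesis by (simp add: Pair c_def r_def J_def cball_eq_atLeastAtMost)
    qed
    have r_pos: "0 < r i" if "i \<in> I" for i
      using that by (cases i) (auto simp: I_def r_def R_def)
    have cov: "\<exists>i. i \<in> I \<and> x \<in> cball (c i) (r i) \<and> r i < d" if x: "x \<in> E k" and d: "0 < d" for x d
    proof -
      have "open (\<gamma> x)" "x \<in> \<gamma> x" using \<gamma> by (auto simp: gauge_def)
      then obtain d' where d': "d' > 0" "cball x d' \<subseteq> \<gamma> x"
        using open_contains_cball by blast
      obtain y where y: "y \<in> {a<..<b}" "\<bar>y - x\<bar> < min d d'" "R x y > \<bar>y - x\<bar> / Suc k"
        using x d d'(1) unfolding E_def by (smt (verit) mem_Collect_eq)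
      have "J (x, y) \<subseteq> cball x d'"
        using y(2) by (auto simp: J_def dist_real_def)
      then have "(x, y) \<in> I"
        using y x d' by (auto simp: I_def E_def)
      moreover have "x \<in> cball (c (x, y)) (r (x, y))"
        unfolding J_cball by (auto simp: J_def)
      moreover have "r (x, y) < d" using y(2) by (auto simp: r_def)
      ultimately show ?thesis by blast
    qed
    obtain C where C: "countable C" "C \<subseteq> I"
      "pairwise (\<lambda>i j. disjnt (cball (c i) (r i)) (cball (c j) (r j))) C"
      "negligible (E k - (\<Union>i\<in>C. cball (c i) (r i)))"
      by (rule Vitali_covering_theorem_cballs[of I r "E k" c, OF r_pos cov])
    \<comment> \<open>Henstock's lemma speaks of finite partial divisions only. The bound does not
      depend on the finite subfamily, so it passes to the countable union.\<close>
    have fin: "measure lebesgue (\<Union>i\<in>C'. J i) \<le> e" if C': "C' \<subseteq> C" "finite C'" for C'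
    proof -
      have disj: "disjnt (J i) (J j)" if "i \<in> C'" "j \<in> C'" "i \<noteq> j" for i j
        using C(3) that C'(1) unfolding J_cball pairwise_def by blast
      have Jne: "fst i \<in> J i" for i by (cases i) (auto simp: J_def)
      define p where "p = (\<lambda>i. (fst i, J i)) ` C'"
      have inj: "inj_on (\<lambda>i. (fst i, J i)) C'"
        using disj Jne by (force simp: inj_on_def disjnt_iff)
      have JI: "J i \<subseteq> \<gamma> (fst i)" "J i \<subseteq> {a..b}" if "i \<in> C'" for i
        using that C' C(2) by (force simp: I_def J_def)+
      have "p tagged_partial_division_of cbox a b"
        unfolding tagged_partial_division_of_def
      proof (intro conjI allI impI)
        show "finite p" using C' by (simp add: p_def)
        fix x K assume xK: "(x, K) \<in> p"
        then obtain i where i: "i \<in> C'" "x = fst i" "K = J i" by (auto simp: p_def)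
        show "x \<in> K" using i Jne by simp
        show "K \<subseteq> cbox a b" using JI(2)[OF i(1)] i by simp
        show "\<exists>a b. K = cbox a b" using i by (cases i) (auto simp: J_def)
      next
        fix x K x' K' assume xK: "(x, K) \<in> p \<and> (x', K') \<in> p \<and> (x, K) \<noteq> (x', K')"
        then obtain i i' where i: "i \<in> C'" "x = fst i" "K = J i"
          and "i' \<in> C'" "x' = fst i'" "K' = J i'" "i \<noteq> i'" by (auto simp: p_def)
        then have "disjnt K K'" using disj i by simp
        then show "interior K \<inter> interior K' = {}"
          using interior_subset by (fastforce simp: disjnt_def)
      qed
      moreover have "\<gamma> fine p" using JI by (auto simp: fine_def p_def)
      ultimately have "(\<Sum>(x,K)\<in>p. norm (measure lborel K *\<^sub>R f x - integral K f)) \<le> 2 * DIM('a) * \<eta>"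
        using Henstock_lemma_part2[of f a b \<eta> \<gamma> p] f \<eta> \<gamma> \<gamma>_less by simp
      also have "(\<Sum>(x,K)\<in>p. norm (measure lborel K *\<^sub>R f x - integral K f))
          = (\<Sum>i\<in>C'. R (fst i) (snd i))"
      proof -
        have "norm (measure lborel (J i) *\<^sub>R f (fst i) - integral (J i) f) = R (fst i) (snd i)"
          if "i \<in> C'" for i
          using R_eq[of "fst i" "snd i"] that C' C(2) by (auto simp: I_def J_def)
        then show ?thesis by (simp add: p_def sum.reindex[OF inj])
      qed
      finally have le: "(\<Sum>i\<in>C'. R (fst i) (snd i)) \<le> 2 * DIM('a) * \<eta>" .
      have "measure lebesgue (\<Union>i\<in>C'. J i) \<le> (\<Sum>i\<in>C'. measure lebesgue (J i))"
        by (rule measure_UNION_le) (use C' in \<open>auto simp: J_def split: prod.splits\<close>)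
      also have "\<dots> \<le> (\<Sum>i\<in>C'. Suc k * R (fst i) (snd i))"
      proof (rule sum_mono)
        fix i assume "i \<in> C'"
        then have "i \<in> I" using C' C by auto
        then have "\<bar>snd i - fst i\<bar> < Suc k * R (fst i) (snd i)"
          by (auto simp: I_def field_simps)
        moreover have "measure lebesgue (J i) = \<bar>snd i - fst i\<bar>"
          by (cases i) (auto simp: J_def)
        ultimately show "measure lebesgue (J i) \<le> Suc k * R (fst i) (snd i)" by simp
      qed
      also have "\<dots> \<le> Suc k * (2 * DIM('a) * \<eta>)"
        using le by (simp add: sum_distrib_left[symmetric] mult_left_mono del: of_nat_Suc)
      also have "\<dots> = e" by (simp add: \<eta>_def del: of_nat_Suc)
      finally show ?thesis .
    qed
    have Jm: "J i \<in> lmeasurable" for i by (cases i) (auto simp: J_def)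
    let ?U = "\<Union>i\<in>C. J i"
    have U: "?U \<in> lmeasurable" "measure lebesgue ?U \<le> e"
      using fmeasurable_UN_bound[OF C(1) Jm fin] measure_UN_bound[OF C(1) Jm fin] by auto
    have N: "negligible (E k - ?U)" using C(4) by (simp add: J_cball)
    show "\<exists>T. E k \<subseteq> T \<and> T \<in> lmeasurable \<and> measure lebesgue T \<le> e"
    proof (intro exI conjI)
      show "E k \<subseteq> ?U \<union> (E k - ?U)" by blast
      show "?U \<union> (E k - ?U) \<in> lmeasurable"
        by (rule fmeasurable.Un[OF U(1) negligible_imp_measurable[OF N]])
      have "measure lebesgue (?U \<union> (E k - ?U)) \<le> measure lebesgue ?U + measure lebesgue (E k - ?U)"
        by (rule measure_Un_le[OF fmeasurableD[OF U(1)] negligible_imp_sets[OF N]])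
      then show "measure lebesgue (?U \<union> (E k - ?U)) \<le> e"
        using U N by (simp add: negligible_imp_measure0)
    qed
  qed
  have "{t \<in> {a<..<b}. \<not> (F has_vector_derivative f t) (at t)} \<subseteq> (\<Union>k. E k)"
  proof clarify
    fix t assume t: "t \<in> {a<..<b}" and nd: "\<not> (F has_vector_derivative f t) (at t)"
    have "bounded_linear (\<lambda>u. u *\<^sub>R f t)" by (rule bounded_linear_scaleR_left)
    with nd obtain e where e: "e > 0" "\<And>d. d > 0 \<Longrightarrow> \<exists>y. \<bar>y - t\<bar> < d \<and> R t y > e * \<bar>y - t\<bar>"
      unfolding has_vector_derivative_def has_derivative_at_alt R_def by (auto simp: not_le)
    obtain k where k: "1 / Suc k < e" using nat_approx_posE[OF e(1)] by auto
    have "t \<in> E k"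
      unfolding E_def
    proof (intro CollectI conjI t allI impI)
      fix d :: real assume "d > 0"
      define d' where "d' = min d (min (t - a) (b - t))"
      have "d' > 0" using \<open>d > 0\<close> t by (simp add: d'_def)
      then obtain y where y: "\<bar>y - t\<bar> < d'" "R t y > e * \<bar>y - t\<bar>" using e by blast
      have "\<bar>y - t\<bar> / Suc k \<le> e * \<bar>y - t\<bar>"
        using mult_right_mono[OF less_imp_le[OF k], of "\<bar>y - t\<bar>"] by simp
      then show "\<exists>y\<in>{a<..<b}. \<bar>y - t\<bar> < d \<and> R t y > \<bar>y - t\<bar> / Suc k"
        using y by (intro bexI[of _ y]) (auto simp: d'_def)
    qed
    then show "t \<in> (\<Union>k. E k)" by blast
  qed
  moreover have "negligible (\<Union>k. E k)" by (rule negligible_countable_Union) (use neg in auto)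
  ultimately show ?thesis unfolding F_def by (rule negligible_subset[rotated])
qed

text \<open>
  Over tags in the exceptional null set \<open>N\<close>, a gauge for the integral of the indicator of \<open>N\<close>
  keeps the total length small, so absolute continuity makes their contribution negligible.
\<close>

lemma has_integral_abs_cont_on:
  fixes x :: "real \<Rightarrow> 'a::euclidean_space"
  assumes ab: "a \<le> b" and ac: "abs_cont_on a b x"
    and der: "AE t in lborel. a < t \<and> t < b \<longrightarrow> (x has_vector_derivative g t) (at t)"
  shows "(g has_integral x b - x a) {a..b}"
proof -
  define N where "N = {t. \<not> (a < t \<and> t < b \<longrightarrow> (x has_vector_derivative g t) (at t))} \<union> {a, b}"
  have "negligible {t. \<not> (a < t \<and> t < b \<longrightarrow> (x has_vector_derivative g t) (at t))}"
    using der by (simp only: AE_lborel_iff_negligible)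
  then have N: "negligible N" unfolding N_def by (intro negligible_Un) auto
  \<comment> \<open>With integrand 0 on \<open>N\<close>, tags in \<open>N\<close> contribute only
    increments of \<open>x\<close>. The endpoints were put into \<open>N\<close> because a two-sided
    derivative is given only in the interior.\<close>
  define h where "h t = (if t \<in> N then 0 else g t)" for t
  have "(h has_integral x b - x a) {a..b}"
    unfolding has_integral_factor_content_real
  proof (intro allI impI)
    fix e :: real assume e: "0 < e"
    show "\<exists>d. gauge d \<and> (\<forall>p. p tagged_division_of {a..b} \<and> d fine p \<longrightarrow>
        norm ((\<Sum>(t, K)\<in>p. measure lborel K *\<^sub>R h t) - (x b - x a)) \<le> e * measure lborel {a..b})"
    \<comment> \<open>On a degenerate interval the allowed error is 0, so no gauge leaves any slack
      and the sums have to vanish exactly.\<close>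
    proof (cases "a = b")
      case True
      have "norm ((\<Sum>(t, K)\<in>p. measure lborel K *\<^sub>R h t) - (x b - x a)) \<le> 0"
        if p: "p tagged_division_of {a..b}" for p
      proof -
        have "(\<Sum>(t, K)\<in>p. measure lborel K *\<^sub>R h t) = 0"
        proof (rule sum.neutral, clarify)
          fix t K assume "(t, K) \<in> p"
          then have "K \<subseteq> {a}" using p True by (metis atLeastAtMost_singleton tagged_division_ofD(3))
          then have "K = {} \<or> K = {a}" by blast
          then show "measure lborel K *\<^sub>R h t = 0" by auto
        qed
        then show ?thesis using True by simp
      qed
      then show ?thesis using True by (intro exI[of _ "\<lambda>x. UNIV"]) (auto simp: gauge_def)
    next
      case False
      with ab have lt: "a < b" by simp
      \<comment> \<open>Half of the allowed error \<open>e * (b - a)\<close> is reserved for tags in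
        \<open>N\<close>; the other half pays for the remaining tags at rate \<open>e/2\<close> per
        unit length.\<close>
      define \<epsilon> where "\<epsilon> = e * (b - a) / 2"
      have \<epsilon>: "\<epsilon> > 0" using e lt by (simp add: \<epsilon>_def)
      have "\<exists>d>0. \<forall>y. norm (y - t) < d \<longrightarrow> norm (x y - x t - (y - t) *\<^sub>R h t) \<le> e/2 * norm (y - t)"
        if "t \<in> {a..b} - N" for t
      proof -
        have "(x has_vector_derivative h t) (at t)" using that by (auto simp: h_def N_def)
        then show ?thesis using half_gt_zero[OF e] unfolding has_vector_derivative_def has_derivative_at_alt by blast
      qed
      then obtain r where r: "\<And>t. t \<in> {a..b} - N \<Longrightarrow> r t > 0"
        "\<And>t y. t \<in> {a..b} - N \<Longrightarrow> norm (y - t) < r t \<Longrightarrow> norm (x y - x t - (y - t) *\<^sub>R h t) \<le> e/2 * norm (y - t)"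
        by metis
      obtain \<delta> where \<delta>: "\<delta> > 0" and ac_less: "\<forall>D. finite D \<longrightarrow>
        (\<forall>(u, v)\<in>D. a \<le> u \<and> u \<le> v \<and> v \<le> b) \<longrightarrow>
        disjoint_family_on (\<lambda>(u, v). {u<..<v}) D \<longrightarrow>
        (\<Sum>(u, v)\<in>D. v - u) < \<delta> \<longrightarrow> (\<Sum>(u, v)\<in>D. norm (x v - x u)) < \<epsilon>"
        using ac \<epsilon> unfolding abs_cont_on_def by blast
      have "((indicator N :: real \<Rightarrow> real) has_integral 0) {a..b}"
        using has_integral_negligible[OF N, of "{a..b}" "indicator N :: real \<Rightarrow> real"] by simp
      then obtain \<gamma> where \<gamma>: "gauge \<gamma>" and \<gamma>_less: "\<And>p. p tagged_division_of {a..b} \<Longrightarrow> \<gamma> fine p \<Longrightarrow>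
          norm ((\<Sum>(t,K)\<in>p. measure lborel K *\<^sub>R (indicator N t::real)) - 0) < \<delta>"
        unfolding has_integral_real using \<delta> by meson
      define d where "d t = \<gamma> t \<inter> (if t \<in> {a..b} - N then ball t (r t) else UNIV)" for t
      have gd: "gauge d" using \<gamma> r(1) by (auto simp: gauge_def d_def)
      have main: "norm ((\<Sum>(t, K)\<in>p. measure lborel K *\<^sub>R h t) - (x b - x a)) \<le> e * measure lborel {a..b}"
        if p: "p tagged_division_of {a..b}" and fine: "d fine p" for p
      proof -
        note p' = tagged_division_ofD[OF p]
        have finp: "finite p" using p by blast
        have K: "\<exists>u v. K = {u..v} \<and> a \<le> u \<and> u \<le> t \<and> t \<le> v \<and> v \<le> b" if "(t, K) \<in> p" for t K
          using p'(2-4)[OF that] by (auto simp: subset_iff)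
        define P where "P = {(t, K) \<in> p. t \<in> N}"
        define I where "I = (\<lambda>(t::real, K::real set). (Inf K, Sup K))"
        have finP: "finite P" using finp by (auto simp: P_def intro: finite_subset)
        have eqK: "K = {fst (I (t,K))..snd (I (t,K))}" "fst (I (t,K)) \<le> snd (I (t,K))" if "(t, K) \<in> p" for t K
          using K[OF that] by (auto simp: I_def)
        \<comment> \<open>Absolute continuity is about a set of endpoint pairs, so tagged intervals
          with equal endpoints are merged. Two such intervals have disjoint interiors and are
          therefore single points, whose increment and length are 0; the sums survive the
          merging.\<close>
        have deg: "fst (I i) = snd (I i)" if "i \<in> p" "j \<in> p" "i \<noteq> j" "I i = I j" for i j
        proof -
          obtain t K where i: "i = (t, K)" by (cases i)
          obtain t' K' where j: "j = (t', K')" by (cases j)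
          have "K = K'" using eqK(1)[of t K] eqK(1)[of t' K'] that i j by simp
          then have "interior K = {}" using p'(5)[of t K t' K'] that i j by auto
          then show ?thesis using eqK[of t K] that(1) i
            by (metis interior_atLeastAtMost_real greaterThanLessThan_empty_iff order_antisym)
        qed
        have re: "(\<Sum>(u, v)\<in>I ` P. F u v) = (\<Sum>(t,K)\<in>P. F (Inf K) (Sup K))"
          if "\<And>u. F u u = 0" for F :: "real \<Rightarrow> real \<Rightarrow> real"
        proof -
          have "(\<Sum>(u, v)\<in>I ` P. F u v) = (\<Sum>i\<in>P. (\<lambda>(u, v). F u v) (I i))"
          proof (subst sum.reindex_nontrivial[OF finP])
            fix i j assume "i \<in> P" "j \<in> P" "i \<noteq> j" "I i = I j"
            then have "fst (I i) = snd (I i)" using deg[of i j] by (auto simp: P_def)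
            then show "(\<lambda>(u, v). F u v) (I i) = 0" using that by (cases "I i") auto
          qed (auto simp: o_def)
          then show ?thesis by (simp add: I_def case_prod_unfold)
        qed
        have "(\<Sum>(u, v)\<in>I ` P. norm (x v - x u)) < \<epsilon>"
        proof (rule ac_less[THEN spec, THEN mp, THEN mp, THEN mp, THEN mp])
          show "finite (I ` P)" using finP by simp
          show "\<forall>(u, v)\<in>I ` P. a \<le> u \<and> u \<le> v \<and> v \<le> b"
            using K by (fastforce simp: P_def I_def)
          show "disjoint_family_on (\<lambda>(u, v). {u<..<v}) (I ` P)"
            unfolding disjoint_family_on_def
          proof (intro ballI impI)
            fix m n assume mn: "m \<in> I ` P" "n \<in> I ` P" "m \<noteq> n"
            then obtain t K t' K' where *: "(t, K) \<in> p" "(t', K') \<in> p" "m = I (t, K)" "n = I (t', K')"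
              by (auto simp: P_def)
            then have "(t, K) \<noteq> (t', K')" using mn by auto
            then have "interior K \<inter> interior K' = {}" using p'(5) * by metis
            moreover have "(case m of (u, v) \<Rightarrow> {u<..<v}) = interior K" "(case n of (u, v) \<Rightarrow> {u<..<v}) = interior K'"
              using eqK * by (metis interior_atLeastAtMost_real case_prod_unfold)+
            ultimately show "(case m of (u, v) \<Rightarrow> {u<..<v}) \<inter> (case n of (u, v) \<Rightarrow> {u<..<v}) = {}" by simp
          qed
          have "(\<Sum>(u, v)\<in>I ` P. v - u) = (\<Sum>(t,K)\<in>P. Sup K - Inf K)" by (rule re) simp
          also have "\<dots> = (\<Sum>(t,K)\<in>P. measure lborel K *\<^sub>R (indicator N t::real))"
          proof (rule sum.cong, goal_cases)
            case (2 i)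
            then show ?case using K by (fastforce simp: P_def)
          qed simp
          also have "\<dots> = (\<Sum>(t,K)\<in>p. measure lborel K *\<^sub>R (indicator N t::real))"
            using finp by (intro sum.mono_neutral_left) (auto simp: P_def indicator_def split: if_splits)
          also have "\<dots> < \<delta>"
          proof -
            have "\<gamma> fine p" using fine by (auto simp: fine_def d_def)
            then show ?thesis using \<gamma>_less[OF p] by auto
          qed
          finally show "(\<Sum>(u, v)\<in>I ` P. v - u) < \<delta>" .
        qed
        then have Ple: "(\<Sum>(t,K)\<in>P. norm (x (Sup K) - x (Inf K))) \<le> \<epsilon>"
          using re[of "\<lambda>u v. norm (x v - x u)"] by simp
        have tag_le: "norm (measure lborel K *\<^sub>R h t - (x (Sup K) - x (Inf K))) \<le> e/2 * measure lborel K"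
          if "(t, K) \<in> p - P" for t K
        proof -
          have tK: "(t, K) \<in> p" using that by simp
          obtain u v where uv: "K = {u..v}" "a \<le> u" "u \<le> t" "t \<le> v" "v \<le> b" using K[OF tK] by auto
          have t: "t \<in> {a..b} - N" using that uv by (auto simp: P_def)
          have "K \<subseteq> ball t (r t)" using fine that t by (force simp: fine_def d_def)
          moreover have "u \<in> K" "v \<in> K" using uv by auto
          ultimately have "norm (u - t) < r t" "norm (v - t) < r t"
            by (auto simp: subset_iff dist_real_def abs_minus_commute)
          from this[THEN r(2)[OF t]]
          have le: "norm (x u - x t - (u - t) *\<^sub>R h t) + norm (x v - x t - (v - t) *\<^sub>R h t) \<le> e/2 * (v - u)"
            using uv by (simp add: algebra_simps)
          have "(v - u) *\<^sub>R h t - (x v - x u) =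
            (x u - x t - (u - t) *\<^sub>R h t) - (x v - x t - (v - t) *\<^sub>R h t)"
            by (simp add: algebra_simps)
          then have "norm ((v - u) *\<^sub>R h t - (x v - x u)) \<le> e/2 * (v - u)"
            using norm_triangle_ineq4 le by (metis order_trans)
          moreover have "u \<le> v" using uv by simp
          ultimately show ?thesis using uv by simp
        qed
        have "(\<Sum>(t, K)\<in>p. measure lborel K *\<^sub>R h t) - (x b - x a)
          = (\<Sum>(t, K)\<in>p. measure lborel K *\<^sub>R h t - (x (Sup K) - x (Inf K)))"
          using additive_tagged_division_1[OF ab p, of x] by (simp add: case_prod_unfold sum_subtractf)
        also have "norm \<dots> \<le> (\<Sum>(t, K)\<in>p. norm (measure lborel K *\<^sub>R h t - (x (Sup K) - x (Inf K))))"
          by (rule order_trans[OF norm_sum]) (simp add: case_prod_unfold)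
        also have "\<dots> = (\<Sum>(t, K)\<in>p - P. norm (measure lborel K *\<^sub>R h t - (x (Sup K) - x (Inf K))))
            + (\<Sum>(t, K)\<in>P. norm (measure lborel K *\<^sub>R h t - (x (Sup K) - x (Inf K))))"
          by (rule sum.subset_diff) (auto simp: P_def finp)
        also have "(\<Sum>(t, K)\<in>P. norm (measure lborel K *\<^sub>R h t - (x (Sup K) - x (Inf K))))
          = (\<Sum>(t, K)\<in>P. norm (x (Sup K) - x (Inf K)))"
          by (rule sum.cong) (auto simp: P_def h_def norm_minus_commute)
        also have "(\<Sum>(t, K)\<in>p - P. norm (measure lborel K *\<^sub>R h t - (x (Sup K) - x (Inf K))))
           \<le> (\<Sum>(t, K)\<in>p - P. e/2 * measure lborel K)"
          using tag_le by (intro sum_mono) auto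
        also have "\<dots> \<le> (\<Sum>(t, K)\<in>p. e/2 * measure lborel K)"
          using finp e by (intro sum_mono2) auto
        also have "\<dots> = e/2 * (\<Sum>(t, K)\<in>p. measure lborel K)"
          by (simp only: case_prod_unfold sum_distrib_left)
        also have "\<dots> = e/2 * (b - a)"
          using additive_content_tagged_division[of p a b] p lt by simp
        finally show ?thesis using Ple lt by (simp add: \<epsilon>_def)
      qed
      show ?thesis by (intro exI[of _ d] conjI allI impI gd main) auto
    qed
  qed
  then show ?thesis
    by (rule has_integral_spike[OF N, rotated]) (auto simp: h_def)
qed

lemma sum_integral_disjoint_le:
  fixes q :: "real \<Rightarrow> real"
  assumes q: "q integrable_on {a..b}" and nonneg: "\<And>t. t \<in> {a..b} \<Longrightarrow> 0 \<le> q t"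
    and D: "finite D" "\<forall>(u, v)\<in>D. a \<le> u \<and> u \<le> v \<and> v \<le> b"
    and disj: "disjoint_family_on (\<lambda>(u, v). {u<..<v}) D"
  shows "(\<Sum>(u, v)\<in>D. integral {u..v} q) \<le> integral {a..b} q"
proof -
  let ?T = "\<lambda>(u, v). {u<..<v::real}" and ?g = "\<lambda>(u, v). integral {u..v} q"
  have "(q has_integral sum ?g D) (\<Union>i\<in>D. ?T i)"
  proof (rule has_integral_UN)
    fix i assume "i \<in> D"
    then obtain u v where uv: "i = (u, v)" "a \<le> u" "v \<le> b" using D by auto
    then have "(q has_integral integral {u..v} q) {u..v}"
      using integrable_on_subinterval[OF q, of u v] by (auto intro: integrable_integral)
    then show "(q has_integral ?g i) (?T i)" using uv by (simp add: has_integral_Icc_iff_Ioo)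
  qed (use D disj in \<open>auto simp: pairwise_def disjoint_family_on_def\<close>)
  then show ?thesis
    using has_integral_subset_le[of "\<Union>i\<in>D. ?T i" "{a..b}" q] integrable_integral[OF q] D nonneg
    by fastforce
qed

text \<open>Truncate \<open>norm (G t)\<close> at height \<open>k\<close>. The excess
  \<open>r k\<close> has integral below \<open>\<epsilon> / 2\<close> for large \<open>k\<close> by
  dominated convergence, over any disjoint family of intervals, and the truncated part contributes
  at most \<open>k\<close> times the total length.\<close>

lemma abs_cont_on_integral:
  fixes G :: "real \<Rightarrow> 'a::euclidean_space"
  assumes G: "G absolutely_integrable_on {a..b}"
    and x: "\<And>t. t \<in> {a..b} \<Longrightarrow> x t = c + integral {a..t} G"
  shows "abs_cont_on a b x"
  unfolding abs_cont_on_def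
proof (intro allI impI)
  fix \<epsilon> :: real assume \<epsilon>: "0 < \<epsilon>"
  define h where "h t = norm (G t)" for t
  define r where "r k t = h t - min (h t) (real k)" for k t
  have h: "h absolutely_integrable_on {a..b}"
    using absolutely_integrable_norm[OF G] by (simp add: h_def[abs_def] o_def)
  have hi: "h integrable_on {a..b}" using h set_lebesgue_integral_eq_integral(1) by blast
  have r: "r k integrable_on {a..b}" for k
  proof -
    have "(\<lambda>t. h t - min (h t) (real k)) absolutely_integrable_on {a..b}"
      by (intro set_integral_diff absolutely_integrable_min_1 h) (auto simp: absolutely_integrable_on_const)
    then show ?thesis unfolding r_def using set_lebesgue_integral_eq_integral(1) by blast
  qed
  have "(\<lambda>k. integral {a..b} (r k)) \<longlonglongrightarrow> integral {a..b} (\<lambda>t. 0)"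
  proof (rule dominated_convergence(2)[OF r hi])
    show "norm (r k t) \<le> h t" for k t by (auto simp: r_def h_def min_def)
    show "(\<lambda>k. r k t) \<longlonglongrightarrow> 0" for t
    proof (rule tendsto_eventually)
      obtain K where "h t \<le> real K" using real_arch_simple by blast
      then have "r k t = 0" if "K \<le> k" for k
        using that by (simp add: r_def min_absorb1 order_trans[OF _ of_nat_mono])
      then show "\<forall>\<^sub>F k in sequentially. r k t = 0"
        by (rule eventually_sequentiallyI)
    qed
  qed
  then have "\<forall>\<^sub>F k in sequentially. integral {a..b} (r k) < \<epsilon> / 2"
    using \<epsilon> by (intro order_tendstoD(2)) auto
  then obtain k where k: "integral {a..b} (r k) < \<epsilon> / 2" by (auto simp: eventually_sequentially)
  define \<delta> where "\<delta> = \<epsilon> / (2 * (real k + 1))"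
  have \<delta>: "\<delta> > 0" using \<epsilon> by (simp add: \<delta>_def)
  have "(\<Sum>(u, v)\<in>D. norm (x v - x u)) < \<epsilon>"
    if D: "finite D" "\<forall>(u, v)\<in>D. a \<le> u \<and> u \<le> v \<and> v \<le> b"
      "disjoint_family_on (\<lambda>(u, v). {u<..<v}) D" "(\<Sum>(u, v)\<in>D. v - u) < \<delta>" for D
  proof -
    have "(\<Sum>(u, v)\<in>D. norm (x v - x u)) \<le> (\<Sum>(u, v)\<in>D. real k * (v - u) + integral {u..v} (r k))"
    proof (rule sum_mono, clarify)
      fix u v assume "(u, v) \<in> D"
      then have uv: "a \<le> u" "u \<le> v" "v \<le> b" using D by auto
      have Gi: "G integrable_on {a..v}" "G integrable_on {u..v}"
        using G uv by (auto intro!: integrable_on_subinterval[OF set_lebesgue_integral_eq_integral(1)[OF G]])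
      have ri: "r k integrable_on {u..v}" using uv by (auto intro: integrable_on_subinterval[OF r])
      have "x v - x u = integral {u..v} G"
        using Henstock_Kurzweil_Integration.integral_combine[OF uv(1,2) Gi(1)] uv by (simp add: x algebra_simps)
      also have "norm \<dots> \<le> integral {u..v} (\<lambda>t. real k + r k t)"
      proof (rule Henstock_Kurzweil_Integration.integral_norm_bound_integral[OF Gi(2)])
        show "(\<lambda>t. real k + r k t) integrable_on {u..v}"
          using ri by (intro integrable_add integrable_const_ivl)
      qed (auto simp: r_def h_def min_def)
      also have "\<dots> = real k * (v - u) + integral {u..v} (r k)"
        using ri uv by (subst Henstock_Kurzweil_Integration.integral_add) auto
      finally show "norm (x v - x u) \<le> real k * (v - u) + integral {u..v} (r k)" .
    qed
    also have "\<dots> = real k * (\<Sum>(u, v)\<in>D. v - u) + (\<Sum>(u, v)\<in>D. integral {u..v} (r k))"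
      by (simp add: case_prod_unfold sum.distrib sum_distrib_left)
    also have "\<dots> \<le> real k * \<delta> + integral {a..b} (r k)"
      using D by (intro add_mono mult_left_mono sum_integral_disjoint_le r) (auto simp: r_def)
    also have "\<dots> < \<epsilon> / 2 + \<epsilon> / 2"
    proof (rule add_le_less_mono[OF _ k])
      show "real k * \<delta> \<le> \<epsilon> / 2" using \<epsilon> by (simp add: \<delta>_def field_simps)
    qed
    finally show ?thesis by simp
  qed
  then show "\<exists>\<delta>>0. \<forall>D. finite D \<longrightarrow> (\<forall>(u, v)\<in>D. a \<le> u \<and> u \<le> v \<and> v \<le> b) \<longrightarrow>
      disjoint_family_on (\<lambda>(u, v). {u<..<v}) D \<longrightarrow> (\<Sum>(u, v)\<in>D. v - u) < \<delta> \<longrightarrow>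
      (\<Sum>(u, v)\<in>D. norm (x v - x u)) < \<epsilon>"
    using \<delta> by blast
qed

section \<open>Superposition with Caratheodory functions\<close>

lemma power_add_le_two_power:
  fixes a b :: real
  assumes "0 \<le> a" "0 \<le> b"
  shows "(a + b) ^ p \<le> 2 ^ p * (a ^ p + b ^ p)"
proof (cases "a \<le> b")
  case True
  then have "(a + b) ^ p \<le> (2 * b) ^ p" using assms by (intro power_mono) auto
  also have "\<dots> \<le> 2 ^ p * (a ^ p + b ^ p)" using assms by (simp add: power_mult_distrib)
  finally show ?thesis .
next
  case False
  then have "(a + b) ^ p \<le> (2 * a) ^ p" using assms by (intro power_mono) auto
  also have "\<dots> \<le> 2 ^ p * (a ^ p + b ^ p)" using assms by (simp add: power_mult_distrib)
  finally show ?thesis .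
qed

lemma set_integrable_lebesgue_iff:
  fixes f :: "real \<Rightarrow> 'a::euclidean_space"
  shows "set_integrable lebesgue {a..b} f \<longleftrightarrow> integrable (lebesgue_on {a..b}) f"
  unfolding set_integrable_def by (subst integrable_restrict_space) auto

text \<open>Absolute values make both functions nonnegative, and
  \<open>\<bar>u\<bar> \<le> 1 + \<bar>u\<bar> ^ p\<close> turns local p-integrability into local
  integrability, which is what integral equations and the Gronwall step consume.\<close>

lemma LC_boundE:
  assumes "f \<in> LC p" "compact K" "1 \<le> p"
  obtains m l where "\<And>t. 0 \<le> m t" "\<And>t. 0 \<le> l t"
    "\<And>a b. m absolutely_integrable_on {a..b}" "\<And>a b. l absolutely_integrable_on {a..b}"
    "\<And>a b. (\<lambda>t. m t ^ p) absolutely_integrable_on {a..b}"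
    "AE t in lborel. \<forall>z\<in>K. norm (f t z) \<le> m t"
    "AE t in lborel. \<forall>z1\<in>K. \<forall>z2\<in>K. norm (f t z1 - f t z2) \<le> l t * norm (z1 - z2)"
proof -
  obtain m l where m: "m \<in> Lp_loc p" and l: "l \<in> Lp_loc p" and ae: "AE t in lborel.
          (\<forall>z\<in>K. norm (f t z) \<le> m t) \<and>
          (\<forall>z1\<in>K. \<forall>z2\<in>K. norm (f t z1 - f t z2) \<le> l t * norm (z1 - z2))"
    using assms unfolding LC_def by blast
  have int: "(\<lambda>t. \<bar>k t\<bar>) absolutely_integrable_on {a..b}" if k: "k \<in> Lp_loc p" for k a b
  proof -
    have 1: "integrable (lebesgue_on {a..b}) (\<lambda>t. 1 + \<bar>k t\<bar> ^ p)"
      using k by (intro Bochner_Integration.integrable_add) (auto simp: Lp_loc_def integrable_restrict_space)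
    have "integrable (lebesgue_on {a..b}) (\<lambda>t. \<bar>k t\<bar>)"
    proof (rule Bochner_Integration.integrable_bound[OF 1])
      show "(\<lambda>t. \<bar>k t\<bar>) \<in> borel_measurable (lebesgue_on {a..b})"
        using k by (auto simp: Lp_loc_def intro!: borel_measurable_abs)
      show "AE t in lebesgue_on {a..b}. norm \<bar>k t\<bar> \<le> norm (1 + \<bar>k t\<bar> ^ p)"
      proof (rule AE_I2)
        fix t
        have "\<bar>k t\<bar> \<le> 1 + \<bar>k t\<bar> ^ p"
        proof (cases "\<bar>k t\<bar> \<le> 1")
          case False
          then have "\<bar>k t\<bar> ^ 1 \<le> \<bar>k t\<bar> ^ p" using assms(3) by (intro power_increasing) auto
          then show ?thesis by simp
        qed (simp add: add_increasing2)
        then show "norm \<bar>k t\<bar> \<le> norm (1 + \<bar>k t\<bar> ^ p)" by simp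
      qed
    qed
    then show ?thesis by (simp add: set_integrable_lebesgue_iff)
  qed
  show thesis
  proof (rule that[of "\<lambda>t. \<bar>m t\<bar>" "\<lambda>t. \<bar>l t\<bar>"])
    show "(\<lambda>t. \<bar>m t\<bar> ^ p) absolutely_integrable_on {a..b}" for a b
      using m by (simp add: set_integrable_lebesgue_iff Lp_loc_def)
    show "AE t in lborel. \<forall>z\<in>K. norm (f t z) \<le> \<bar>m t\<bar>"
      using ae by eventually_elim force
    show "AE t in lborel. \<forall>z1\<in>K. \<forall>z2\<in>K. norm (f t z1 - f t z2) \<le> \<bar>l t\<bar> * norm (z1 - z2)"
      using ae by eventually_elim (meson abs_ge_self mult_right_mono norm_ge_zero order_trans)
  qed (use m l int in auto)
qed

lemma Lp_loc_add:
  assumes "m \<in> Lp_loc p" "k \<in> Lp_loc p"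
  shows "(\<lambda>t. m t + k t) \<in> Lp_loc p"
proof -
  have "integrable (lebesgue_on {a..b}) (\<lambda>t. \<bar>m t + k t\<bar> ^ p)" for a b
  proof (rule Bochner_Integration.integrable_bound)
    show "integrable (lebesgue_on {a..b}) (\<lambda>t. 2 ^ p * (\<bar>m t\<bar> ^ p + \<bar>k t\<bar> ^ p))"
      using assms by (intro integrable_mult_right Bochner_Integration.integrable_add) (auto simp: Lp_loc_def)
    have "m \<in> borel_measurable (lebesgue_on {a..b})" "k \<in> borel_measurable (lebesgue_on {a..b})"
      using assms by (auto simp: Lp_loc_def)
    then show "(\<lambda>t. \<bar>m t + k t\<bar> ^ p) \<in> borel_measurable (lebesgue_on {a..b})" by measurable
    have "\<bar>m t + k t\<bar> ^ p \<le> 2 ^ p * (\<bar>m t\<bar> ^ p + \<bar>k t\<bar> ^ p)" for t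
      by (rule order_trans[OF power_mono[OF abs_triangle_ineq] power_add_le_two_power]) auto
    then show "AE t in lebesgue_on {a..b}. norm (\<bar>m t + k t\<bar> ^ p) \<le> norm (2 ^ p * (\<bar>m t\<bar> ^ p + \<bar>k t\<bar> ^ p))"
      by (auto intro!: AE_I2 order_trans[OF _ abs_ge_self])
  qed
  then show ?thesis using assms unfolding Lp_loc_def by (auto intro!: borel_measurable_add)
qed

text \<open>Convergence is tested by seminorms of \<open>fs n - f\<close>. The real-valued supremum
  and integral in them carry their usual meaning for members of \<open>LC p\<close>, so the
  difference has to be one.\<close>

lemma LC_diff:
  assumes f: "f \<in> LC p" and g: "g \<in> LC p"
  shows "(\<lambda>t z. f t z - g t z) \<in> LC p"
  unfolding LC_def
proof (intro CollectI conjI allI impI)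
  have "(\<lambda>(t, z). f t z) \<in> borel_measurable borel" "(\<lambda>(t, z). g t z) \<in> borel_measurable borel"
    using f g by (auto simp: LC_def)
  then show "(\<lambda>(t, z). f t z - g t z) \<in> borel_measurable borel"
    unfolding case_prod_unfold by (rule borel_measurable_diff)
  fix K :: "'a set" assume K: "compact K"
  obtain m l where ml: "m \<in> Lp_loc p" "l \<in> Lp_loc p" "AE t in lborel.
          (\<forall>z\<in>K. norm (f t z) \<le> m t) \<and>
          (\<forall>z1\<in>K. \<forall>z2\<in>K. norm (f t z1 - f t z2) \<le> l t * norm (z1 - z2))"
    using f K unfolding LC_def by blast
  obtain m' l' where ml': "m' \<in> Lp_loc p" "l' \<in> Lp_loc p" "AE t in lborel.
          (\<forall>z\<in>K. norm (g t z) \<le> m' t) \<and>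
          (\<forall>z1\<in>K. \<forall>z2\<in>K. norm (g t z1 - g t z2) \<le> l' t * norm (z1 - z2))"
    using g K unfolding LC_def by blast
  have "AE t in lborel. (\<forall>z\<in>K. norm (f t z - g t z) \<le> m t + m' t) \<and>
      (\<forall>z1\<in>K. \<forall>z2\<in>K. norm (f t z1 - g t z1 - (f t z2 - g t z2)) \<le> (l t + l' t) * norm (z1 - z2))"
    using ml(3) ml'(3)
  proof eventually_elim
    case (elim t)
    show ?case
    proof (intro conjI ballI)
      fix z assume "z \<in> K"
      then show "norm (f t z - g t z) \<le> m t + m' t"
        using elim norm_triangle_ineq4[of "f t z" "g t z"] by (meson add_mono order_trans)
    next
      fix z1 z2 assume z: "z1 \<in> K" "z2 \<in> K"
      have "f t z1 - g t z1 - (f t z2 - g t z2) = (f t z1 - f t z2) - (g t z1 - g t z2)" by simp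
      then have "norm (f t z1 - g t z1 - (f t z2 - g t z2)) \<le> norm (f t z1 - f t z2) + norm (g t z1 - g t z2)"
        by (metis norm_triangle_ineq4)
      also have "\<dots> \<le> l t * norm (z1 - z2) + l' t * norm (z1 - z2)"
        using elim z by (intro add_mono) auto
      finally show "norm (f t z1 - g t z1 - (f t z2 - g t z2)) \<le> (l t + l' t) * norm (z1 - z2)"
        by (simp add: algebra_simps)
    qed
  qed
  then show "\<exists>m\<in>Lp_loc p. \<exists>l\<in>Lp_loc p. AE t in lborel. (\<forall>z\<in>K. norm (f t z - g t z) \<le> m t) \<and>
      (\<forall>z1\<in>K. \<forall>z2\<in>K. norm (f t z1 - g t z1 - (f t z2 - g t z2)) \<le> l t * norm (z1 - z2))"
    using Lp_loc_add[OF ml(1) ml'(1)] Lp_loc_add[OF ml(2) ml'(2)]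
    by (intro bexI[of _ "\<lambda>t. m t + m' t"] bexI[of _ "\<lambda>t. l t + l' t"])
qed

lemma LC_comp_measurable:
  assumes f: "f \<in> LC p" and z: "continuous_on {a..b} z"
  shows "set_borel_measurable lborel {a..b} (\<lambda>t. f t (z t))"
proof -
  \<comment> \<open>Cutting \<open>z\<close> off outside the interval gives a Borel curve on the
    whole line, so that joint Borel measurability of \<open>f\<close> applies to
    \<open>(t, w t)\<close>. The indicator then hides the values that were changed.\<close>
  define w where "w t = indicator {a..b} t *\<^sub>R z t" for t :: real
  have "w \<in> borel_measurable borel"
    unfolding w_def by (rule borel_measurable_continuous_on_indicator[OF _ z]) auto
  then have "(\<lambda>t. (t, w t)) \<in> borel_measurable borel" by measurable
  moreover have "(\<lambda>(t, z). f t z) \<in> borel_measurable borel" using f by (simp add: LC_def)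
  ultimately have "(\<lambda>t. f t (w t)) \<in> borel_measurable borel"
    using measurable_compose[of "\<lambda>t. (t, w t)" borel borel "\<lambda>(t, z). f t z" borel] by simp
  then have "(\<lambda>t. indicator {a..b} t *\<^sub>R f t (w t)) \<in> borel_measurable borel" by measurable
  also have "(\<lambda>t. indicator {a..b} t *\<^sub>R f t (w t)) = (\<lambda>t. indicator {a..b} t *\<^sub>R f t (z t))"
    by (auto simp: w_def indicator_def)
  finally show ?thesis by (simp add: set_borel_measurable_def)
qed

text \<open>The dominating function is only Lebesgue measurable, as in \<open>Lp_loc\<close>, while
  the conclusion concerns Borel measure. The domination takes place in the completion, and Borel
  measurability of \<open>g\<close> brings integrability back.\<close>

lemma set_integrable_lborel_bound:
  fixes g :: "real \<Rightarrow> 'a::euclidean_space" and h :: "real \<Rightarrow> real"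
  assumes g: "set_borel_measurable lborel {a..b} g" and h: "h absolutely_integrable_on {a..b}"
    and le: "AE t in lborel. t \<in> {a..b} \<longrightarrow> norm (g t) \<le> h t"
  shows "set_integrable lborel {a..b} g"
proof -
  let ?g = "\<lambda>t. indicator {a..b} t *\<^sub>R g t"
  have m: "?g \<in> borel_measurable lborel" using g by (simp add: set_borel_measurable_def)
  have "AE t in lborel. norm (?g t) \<le> norm (indicator {a..b} t *\<^sub>R h t)"
    using le by eventually_elim (auto simp: indicator_def)
  then have "integrable lebesgue ?g"
    using h m unfolding set_integrable_def
    by (elim Bochner_Integration.integrable_bound) (auto intro: measurable_completion AE_completion)
  then show ?thesis using integrable_completion[OF m] by (simp add: set_integrable_def)
qed

lemma LC_comp_integrable:
  assumes f: "f \<in> LC p" and p: "1 \<le> p" and z: "continuous_on {a..b} z"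
  shows "set_integrable lborel {a..b} (\<lambda>t. f t (z t))"
    and "set_integrable lborel {a..b} (\<lambda>t. norm (f t (z t)) ^ p)"
    and "(\<lambda>t. f t (z t)) absolutely_integrable_on {a..b}"
proof -
  have K: "compact (z ` {a..b})" using z by (simp add: compact_continuous_image)
  obtain m l where m0: "\<And>t. 0 \<le> m t" "\<And>t. 0 \<le> l t"
    and m: "\<And>a b. m absolutely_integrable_on {a..b}" "\<And>a b. l absolutely_integrable_on {a..b}"
    "\<And>a b. (\<lambda>t. m t ^ p) absolutely_integrable_on {a..b}"
    "AE t in lborel. \<forall>w\<in>z ` {a..b}. norm (f t w) \<le> m t"
    "AE t in lborel. \<forall>z1\<in>z ` {a..b}. \<forall>z2\<in>z ` {a..b}. norm (f t z1 - f t z2) \<le> l t * norm (z1 - z2)"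
    by (rule LC_boundE[OF f K p]) (rule that)
  have meas: "set_borel_measurable lborel {a..b} (\<lambda>t. f t (z t))" by (rule LC_comp_measurable[OF f z])
  have ae: "AE t in lborel. t \<in> {a..b} \<longrightarrow> norm (f t (z t)) \<le> m t" using m(4) by eventually_elim auto
  then have ae_p: "AE t in lborel. t \<in> {a..b} \<longrightarrow> norm (norm (f t (z t)) ^ p) \<le> m t ^ p"
    by eventually_elim (auto intro!: power_mono)
  show 1: "set_integrable lborel {a..b} (\<lambda>t. f t (z t))"
    by (rule set_integrable_lborel_bound[OF meas m(1) ae])
  have "(\<lambda>t. norm (indicator {a..b} t *\<^sub>R f t (z t)) ^ p) \<in> borel_measurable lborel"
    using meas unfolding set_borel_measurable_def by measurable
  also have "(\<lambda>t. norm (indicator {a..b} t *\<^sub>R f t (z t)) ^ p) =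
      (\<lambda>t. indicator {a..b} t *\<^sub>R norm (f t (z t)) ^ p)"
    using p by (auto simp: indicator_def)
  finally have "set_borel_measurable lborel {a..b} (\<lambda>t. norm (f t (z t)) ^ p)"
    by (simp add: set_borel_measurable_def)
  then show "set_integrable lborel {a..b} (\<lambda>t. norm (f t (z t)) ^ p)"
    by (rule set_integrable_lborel_bound[OF _ m(3) ae_p])
  show "(\<lambda>t. f t (z t)) absolutely_integrable_on {a..b}"
    using 1 meas integrable_completion[of "\<lambda>t. indicator {a..b} t *\<^sub>R f t (z t)" lborel]
    by (simp add: set_integrable_def set_borel_measurable_def)
qed

text \<open>A real supremum dominates its members only if the family is bounded above. The function
  \<open>m\<close> of the ball provides one bound for all curves at once.\<close>

lemma TB_seminorm_upper:
  assumes g: "g \<in> LC p" and p: "1 \<le> p" and z: "continuous_on {q1..q2} z" "z ` {q1..q2} \<subseteq> cball 0 (real j)"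
  shows "root p (set_lebesgue_integral lborel {q1..q2} (\<lambda>t. norm (g t (z t)) ^ p)) \<le> TB_seminorm p q1 q2 j g"
proof -
  let ?Z = "{z. continuous_on {q1..q2} z \<and> z ` {q1..q2} \<subseteq> cball 0 (real j)}"
  let ?I = "\<lambda>z. set_lebesgue_integral lborel {q1..q2} (\<lambda>t. norm (g t (z t)) ^ p)"
  obtain m l where m0: "\<And>t. 0 \<le> m t" "\<And>t. 0 \<le> l t"
    and m: "\<And>a b. m absolutely_integrable_on {a..b}" "\<And>a b. l absolutely_integrable_on {a..b}"
    "\<And>a b. (\<lambda>t. m t ^ p) absolutely_integrable_on {a..b}"
    "AE t in lborel. \<forall>w\<in>cball 0 (real j). norm (g t w) \<le> m t"
    "AE t in lborel. \<forall>z1\<in>cball 0 (real j). \<forall>z2\<in>cball 0 (real j). norm (g t z1 - g t z2) \<le> l t * norm (z1 - z2)"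
    by (rule LC_boundE[OF g compact_cball p]) (rule that)
  have "root p (?I z) \<le> root p (set_lebesgue_integral lebesgue {q1..q2} (\<lambda>t. m t ^ p))" if "z \<in> ?Z" for z
  proof -
    have z: "continuous_on {q1..q2} z" "z ` {q1..q2} \<subseteq> cball 0 (real j)" using that by auto
    have int: "set_integrable lborel {q1..q2} (\<lambda>t. norm (g t (z t)) ^ p)"
      by (rule LC_comp_integrable(2)[OF g p z(1)])
    then have meas: "(\<lambda>t. indicator {q1..q2} t *\<^sub>R norm (g t (z t)) ^ p) \<in> borel_measurable lborel"
      unfolding set_integrable_def by (rule borel_measurable_integrable)
    have "?I z = set_lebesgue_integral lebesgue {q1..q2} (\<lambda>t. norm (g t (z t)) ^ p)"
      unfolding set_lebesgue_integral_def by (rule integral_completion[OF meas, symmetric])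
    also have "\<dots> \<le> set_lebesgue_integral lebesgue {q1..q2} (\<lambda>t. m t ^ p)"
    proof (rule set_integral_mono_AE[OF _ m(3)])
      show "set_integrable lebesgue {q1..q2} (\<lambda>t. norm (g t (z t)) ^ p)"
        using int integrable_completion[OF meas] by (simp add: set_integrable_def)
      have "AE t in lborel. t \<in> {q1..q2} \<longrightarrow> norm (g t (z t)) ^ p \<le> m t ^ p"
        using m(4)
      proof eventually_elim
        case (elim t)
        then show ?case using z(2) by (blast intro: power_mono norm_ge_zero)
      qed
      then show "AE t\<in>{q1..q2} in lebesgue. norm (g t (z t)) ^ p \<le> m t ^ p"
        by (rule AE_completion)
    qed
    finally show ?thesis using p by (simp add: real_root_le_iff)
  qed
  then have "bdd_above ((\<lambda>z. root p (?I z)) ` ?Z)" by (rule bdd_aboveI2)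
  then show ?thesis
    unfolding TB_seminorm_def using z by (intro cSUP_upper) auto
qed

lemma TB_seminorm_nonneg:
  assumes g: "g \<in> LC p" and p: "1 \<le> p"
  shows "0 \<le> TB_seminorm p q1 q2 j g"
proof -
  have "0 \<le> root p (set_lebesgue_integral lborel {q1..q2} (\<lambda>t. norm (g t 0) ^ p))"
    using p by (intro real_root_ge_zero) (simp add: set_lebesgue_integral_def)
  also have "\<dots> \<le> TB_seminorm p q1 q2 j g"
    by (rule TB_seminorm_upper[OF g p]) auto
  finally show ?thesis .
qed

text \<open>The generating set centred at the limit \<open>f\<close> itself is an open neighbourhood
  of \<open>f\<close>, since the seminorm of the zero function vanishes.\<close>

lemma TB_limit_seminorm:
  fixes f :: "real \<Rightarrow> 'z::euclidean_space \<Rightarrow> 'w::euclidean_space"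
  assumes lim: "limitin (TB p) fs f sequentially" and p: "1 \<le> p" and f: "f \<in> LC p"
    and q: "q1 \<in> \<rat>" "q2 \<in> \<rat>" "q1 \<le> q2" and \<epsilon>: "0 < \<epsilon>"
  shows "\<forall>\<^sub>F n in sequentially. TB_seminorm p q1 q2 j (\<lambda>t z. fs n t z - f t z) < \<epsilon>"
proof -
  let ?U = "{g \<in> LC p. TB_seminorm p q1 q2 j (\<lambda>t z. g t z - f t z) < \<epsilon>}"
  have "openin (TB p) ?U"
    unfolding TB_def by (rule topology_generated_by_Basis) (use f q \<epsilon> in blast)
  moreover have "TB_seminorm p q1 q2 j (\<lambda>t z. f t z - f t z) = 0"
  proof -
    have "{z :: real \<Rightarrow> 'z. continuous_on {q1..q2} z \<and> z ` {q1..q2} \<subseteq> cball 0 (real j)} \<noteq> {}"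
      by (auto intro!: exI[of _ "\<lambda>_. 0"])
    then show ?thesis using p by (simp add: TB_seminorm_def power_0_left del: Collect_empty_eq)
  qed
  ultimately have "\<forall>\<^sub>F n in sequentially. fs n \<in> ?U"
    using lim f \<epsilon> by (intro limitinD[OF lim]) auto
  then show ?thesis by eventually_elim auto
qed

text \<open>The pointwise bound \<open>u \<le> \<eta> + u ^ p / \<eta> ^ (p - 1)\<close> replaces Hoelder's inequality.\<close>

lemma LC_comp_integral_norm_le:
  assumes g: "g \<in> LC p" and p: "1 \<le> p" and z: "continuous_on {q1..q2} z" "z ` {q1..q2} \<subseteq> cball 0 (real j)"
    and \<eta>: "0 < \<eta>" and q: "q1 \<le> q2"
  shows "integral {q1..q2} (\<lambda>t. norm (g t (z t))) \<le> \<eta> * (q2 - q1) + TB_seminorm p q1 q2 j g ^ p / \<eta> ^ (p - 1)"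
proof -
  note int = LC_comp_integrable[OF g p z(1)]
  have pi: "(\<lambda>t. norm (g t (z t)) ^ p) integrable_on {q1..q2}"
    by (rule set_borel_integral_eq_integral(1)[OF int(2)])
  have ni: "(\<lambda>t. norm (g t (z t))) integrable_on {q1..q2}"
    using int(3) unfolding absolutely_integrable_on_def by blast
  have le: "u \<le> \<eta> + u ^ p / \<eta> ^ (p - 1)" if u: "0 \<le> u" for u :: real
  proof (cases "u \<le> \<eta>")
    case False
    have "u * \<eta> ^ (p - 1) \<le> u * u ^ (p - 1)"
      using False \<eta> u by (intro mult_left_mono power_mono) auto
    also have "\<dots> = u ^ p" using p by (simp add: power_eq_if)
    finally have "u \<le> u ^ p / \<eta> ^ (p - 1)" using \<eta> by (simp add: field_simps)
    then show ?thesis using \<eta> by simp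
  qed (use u \<eta> in \<open>simp add: add_increasing2\<close>)
  have "integral {q1..q2} (\<lambda>t. norm (g t (z t))) \<le> integral {q1..q2} (\<lambda>t. \<eta> + norm (g t (z t)) ^ p / \<eta> ^ (p - 1))"
    using le by (intro Henstock_Kurzweil_Integration.integral_le ni integrable_add integrable_on_divide pi integrable_const_ivl) auto
  also have "\<dots> = integral {q1..q2} (\<lambda>t. \<eta>) + integral {q1..q2} (\<lambda>t. norm (g t (z t)) ^ p / \<eta> ^ (p - 1))"
    by (intro Henstock_Kurzweil_Integration.integral_add integrable_on_divide pi integrable_const_ivl)
  also have "\<dots> = \<eta> * (q2 - q1) + integral {q1..q2} (\<lambda>t. norm (g t (z t)) ^ p) / \<eta> ^ (p - 1)"
    using q by simp
  also have "integral {q1..q2} (\<lambda>t. norm (g t (z t)) ^ p) \<le> TB_seminorm p q1 q2 j g ^ p"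
  proof -
    have 0: "0 \<le> integral {q1..q2} (\<lambda>t. norm (g t (z t)) ^ p)"
      by (rule Henstock_Kurzweil_Integration.integral_nonneg[OF pi]) simp
    have "root p (integral {q1..q2} (\<lambda>t. norm (g t (z t)) ^ p)) \<le> TB_seminorm p q1 q2 j g"
      using TB_seminorm_upper[OF g p z] set_borel_integral_eq_integral(2)[OF int(2)] by simp
    then have "root p (integral {q1..q2} (\<lambda>t. norm (g t (z t)) ^ p)) ^ p \<le> TB_seminorm p q1 q2 j g ^ p"
      using 0 p by (intro power_mono) (auto intro: real_root_ge_zero)
    then show ?thesis using 0 p by (simp add: real_root_pow_pos2)
  qed
  finally show ?thesis using \<eta> by (simp add: divide_right_mono)
qed

text \<open>Passes from the p-th power to the plain integral needed in the integral equation. The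
  quantifier order is the point: the index from which the bound holds is the same for all curves in
  the ball, including curves that depend on \<open>n\<close>.\<close>

lemma TB_limit_integral:
  fixes f :: "real \<Rightarrow> 'z::euclidean_space \<Rightarrow> 'w::euclidean_space"
  assumes lim: "limitin (TB p) fs f sequentially" and p: "1 \<le> p" and f: "f \<in> LC p"
    and fs: "\<And>n. fs n \<in> LC p"
    and q: "q1 \<in> \<rat>" "q2 \<in> \<rat>" "q1 \<le> q2" and \<epsilon>: "0 < \<epsilon>"
  shows "\<forall>\<^sub>F n in sequentially. \<forall>z. continuous_on {q1..q2} z \<longrightarrow> z ` {q1..q2} \<subseteq> cball 0 (real j) \<longrightarrow>
      integral {q1..q2} (\<lambda>t. norm (fs n t (z t) - f t (z t))) < \<epsilon>"
proof -
  define \<eta> where "\<eta> = \<epsilon> / (4 * (q2 - q1 + 1))"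
  have \<eta>: "\<eta> > 0" "\<eta> * (q2 - q1) < \<epsilon> / 2"
  proof -
    show "\<eta> > 0" using \<epsilon> q(3) by (simp add: \<eta>_def)
    have "\<epsilon> * (q2 - q1) < \<epsilon> * (2 * (q2 - q1 + 1))" using \<epsilon> q(3) by (intro mult_strict_left_mono) auto
    then show "\<eta> * (q2 - q1) < \<epsilon> / 2" using q(3) by (simp add: \<eta>_def field_simps)
  qed
  \<comment> \<open>\<open>\<eta>\<close> is fixed first, so the divisor
    \<open>\<eta> ^ (p - 1)\<close> is a constant here. The cap 1 ensures that the p-th power of a
    seminorm below \<open>s\<close> is at most the seminorm.\<close>
  define s where "s = min 1 (\<epsilon> / 2 * \<eta> ^ (p - 1))"
  have s: "s > 0" using \<epsilon> \<eta> by (simp add: s_def)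
  have "\<forall>\<^sub>F n in sequentially. TB_seminorm p q1 q2 j (\<lambda>t z. fs n t z - f t z) < s"
    by (rule TB_limit_seminorm[OF lim p f q s])
  then show ?thesis
  proof eventually_elim
    case (elim n)
    let ?S = "TB_seminorm p q1 q2 j (\<lambda>t z. fs n t z - f t z)"
    have g: "(\<lambda>t z. fs n t z - f t z) \<in> LC p" by (rule LC_diff[OF fs f])
    have S0: "0 \<le> ?S" by (rule TB_seminorm_nonneg[OF g p])
    have "?S ^ p \<le> ?S ^ 1" using S0 elim p by (intro power_decreasing) (auto simp: s_def)
    also have "\<dots> < \<epsilon> / 2 * \<eta> ^ (p - 1)" using elim by (simp add: s_def)
    finally have le: "?S ^ p / \<eta> ^ (p - 1) < \<epsilon> / 2" using \<eta>(1) by (simp add: field_simps)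
    show ?case
    proof (intro allI impI)
      fix z :: "real \<Rightarrow> 'z" assume "continuous_on {q1..q2} z" "z ` {q1..q2} \<subseteq> cball 0 (real j)"
      from LC_comp_integral_norm_le[OF g p this \<eta>(1) q(3)] le \<eta>(2)
      show "integral {q1..q2} (\<lambda>t. norm (fs n t (z t) - f t (z t))) < \<epsilon>" by linarith
    qed
  qed
qed

section \<open>Existence and continuation of solutions\<close>

text \<open>The gauge integral bound wants a pointwise inequality everywhere. Replacing
  \<open>h\<close> by \<open>norm (g t)\<close> on the exceptional null set achieves this without
  changing its integral, and without assuming that \<open>norm (g t)\<close> is integrable.\<close>

lemma integral_norm_le_AE:
  fixes g :: "real \<Rightarrow> 'a::euclidean_space"
  assumes g: "(g has_integral I) {a..b}" and h: "h integrable_on {a..b}"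
    and le: "AE t in lborel. t \<in> {a..b} \<longrightarrow> norm (g t) \<le> h t"
  shows "norm I \<le> integral {a..b} h"
proof -
  define N where "N = {t. \<not> (t \<in> {a..b} \<longrightarrow> norm (g t) \<le> h t)}"
  have N: "negligible N" using le unfolding N_def AE_lborel_iff_negligible .
  define k where "k t = (if t \<in> N then norm (g t) else h t)" for t
  have k: "(k has_integral integral {a..b} h) {a..b}"
    by (rule has_integral_spike[OF N _ integrable_integral[OF h]]) (auto simp: k_def)
  have "norm (integral {a..b} g) \<le> integral {a..b} k"
    by (rule Henstock_Kurzweil_Integration.integral_norm_bound_integral)
       (use g k in \<open>auto simp: k_def N_def integrable_on_def\<close>)
  then show ?thesis using integral_unique[OF g] integral_unique[OF k] by simp
qed

lemma abs_cont_on_subinterval: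
  assumes "abs_cont_on a b x" "a \<le> c" "d \<le> b"
  shows "abs_cont_on c d x"
  unfolding abs_cont_on_def
proof (intro allI impI)
  fix \<epsilon> :: real assume "0 < \<epsilon>"
  then obtain \<delta> where \<delta>: "\<delta> > 0" "\<forall>D. finite D \<longrightarrow>
      (\<forall>(u, v)\<in>D. a \<le> u \<and> u \<le> v \<and> v \<le> b) \<longrightarrow>
      disjoint_family_on (\<lambda>(u, v). {u<..<v}) D \<longrightarrow>
      (\<Sum>(u, v)\<in>D. v - u) < \<delta> \<longrightarrow> (\<Sum>(u, v)\<in>D. norm (x v - x u)) < \<epsilon>"
    using assms(1) unfolding abs_cont_on_def by blast
  show "\<exists>\<delta>>0. \<forall>D. finite D \<longrightarrow>
      (\<forall>(u, v)\<in>D. c \<le> u \<and> u \<le> v \<and> v \<le> d) \<longrightarrow>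
      disjoint_family_on (\<lambda>(u, v). {u<..<v}) D \<longrightarrow>
      (\<Sum>(u, v)\<in>D. v - u) < \<delta> \<longrightarrow> (\<Sum>(u, v)\<in>D. norm (x v - x u)) < \<epsilon>"
  proof (intro exI[of _ \<delta>] conjI allI impI)
    fix D assume D: "finite D" "\<forall>(u, v)\<in>D. c \<le> u \<and> u \<le> v \<and> v \<le> d"
      "disjoint_family_on (\<lambda>(u, v). {u<..<v}) D" "(\<Sum>(u, v)\<in>D. v - u) < \<delta>"
    have "\<forall>(u, v)\<in>D. a \<le> u \<and> u \<le> v \<and> v \<le> b"
      using D(2) assms(2,3) by fastforce
    then show "(\<Sum>(u, v)\<in>D. norm (x v - x u)) < \<epsilon>"
      using \<delta>(2)[THEN spec, THEN mp, THEN mp, THEN mp, THEN mp, OF D(1) _ D(3,4)] by simp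
  qed (rule \<delta>(1))
qed

lemma delay_solution_has_integral:
  assumes sol: "delay_solution f \<phi> b x" and st: "0 \<le> s" "s \<le> t" "ereal t < b"
  shows "((\<lambda>r. f r (x r, x (r - 1))) has_integral x t - x s) {s..t}"
proof (rule has_integral_abs_cont_on[OF st(2)])
  have "abs_cont_on 0 t x" using sol st unfolding delay_solution_def by simp
  then show "abs_cont_on s t x" using abs_cont_on_subinterval st(1) by blast
  have "AE r in lborel. 0 < r \<and> ereal r < b \<longrightarrow>
        (x has_vector_derivative f r (x r, x (r - 1))) (at r)"
    using sol by (simp add: delay_solution_def)
  then show "AE r in lborel. s < r \<and> r < t \<longrightarrow> (x has_vector_derivative f r (x r, x (r - 1))) (at r)"
  proof eventually_elim
    case (elim r)
    have "ereal r < b" if "r < t" using less_trans[of "ereal r" "ereal t" b] that st(3) by simp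
    then show ?case using elim st(1) by auto
  qed
qed

lemma continuous_on_delay_pair:
  assumes "continuous_on {-1..d::real} x" "0 \<le> c"
  shows "continuous_on {c..d} (\<lambda>r. (x r, x (r - 1)))"
  using assms(2) by (auto intro!: continuous_intros continuous_on_compose2[OF assms(1)])

text \<open>Absolute continuity comes from the integrability of the right-hand side along
  \<open>y\<close>, the derivative from Lebesgue differentiation. This certifies a constructed
  continuation in the sense in which maximality forbids one.\<close>

lemma delay_solution_of_integral:
  fixes f :: "real \<Rightarrow> 'a \<times> 'a \<Rightarrow> 'a::euclidean_space"
  assumes f: "f \<in> LC p" and p: "1 \<le> p" and d: "0 < d" and y: "continuous_on {-1..d} y"
    and init: "\<And>t. t \<in> {-1..0} \<Longrightarrow> y t = \<phi> t"
    and eq: "\<And>t. t \<in> {0..d} \<Longrightarrow> y t = y0 + integral {0..t} (\<lambda>r. f r (y r, y (r - 1)))"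
  shows "delay_solution f \<phi> (ereal d) y"
  unfolding delay_solution_def
proof (intro conjI ballI allI impI)
  let ?G = "\<lambda>r. f r (y r, y (r - 1))"
  have G: "?G absolutely_integrable_on {0..d}"
    by (rule LC_comp_integrable(3)[OF f p continuous_on_delay_pair[OF y]]) simp
  show "0 < ereal d" using d by simp
  show "continuous_on {t. -1 \<le> t \<and> ereal t < ereal d} y"
    by (rule continuous_on_subset[OF y]) auto
  show "y t = \<phi> t" if "t \<in> {-1..0}" for t using init that .
  show "abs_cont_on 0 T y" if "0 \<le> T" "ereal T < ereal d" for T
    by (rule abs_cont_on_subinterval[OF abs_cont_on_integral[OF G eq]]) (use that in auto)
  have "AE t in lborel. \<not> (t \<in> {0<..<d} \<and> \<not> ((\<lambda>u. integral {0..u} ?G) has_vector_derivative ?G t) (at t))"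
    unfolding AE_lborel_iff_negligible
    using lebesgue_differentiation[OF set_lebesgue_integral_eq_integral(1)[OF G]]
    by (rule negligible_subset) auto
  then show "AE t in lborel. 0 < t \<and> ereal t < ereal d \<longrightarrow> (y has_vector_derivative ?G t) (at t)"
  proof eventually_elim
    case (elim t)
    show ?case
    proof
      assume t: "0 < t \<and> ereal t < ereal d"
      then have "((\<lambda>u. integral {0..u} ?G) has_vector_derivative ?G t) (at t)" using elim by auto
      then have "((\<lambda>u. y0 + integral {0..u} ?G) has_vector_derivative ?G t) (at t)"
        using has_vector_derivative_add[OF has_vector_derivative_const] by fastforce
      then show "(y has_vector_derivative ?G t) (at t)"
        by (rule has_vector_derivative_transform_within_open[of _ _ _ "{0<..<d}"]) (use t eq in auto)
    qed
  qed
qed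

text \<open>Picard iteration: the bound 1 keeps the integral operator inside the unit ball about the
  constant \<open>Y\<close>, and the factor 1/2 makes it a contraction in the supremum
  metric.\<close>

lemma integral_equation_solution:
  fixes F :: "real \<Rightarrow> 'a \<Rightarrow> 'a::euclidean_space"
  assumes cd: "c \<le> d"
    and int: "\<And>u. continuous_on {c..d} u \<Longrightarrow> u ` {c..d} \<subseteq> cball Y 1 \<Longrightarrow>
      (\<lambda>r. F r (u r)) integrable_on {c..d}"
    and bound: "\<And>u t. continuous_on {c..d} u \<Longrightarrow> u ` {c..d} \<subseteq> cball Y 1 \<Longrightarrow> t \<in> {c..d} \<Longrightarrow>
      norm (integral {c..t} (\<lambda>r. F r (u r))) \<le> 1"
    and lipschitz: "\<And>u v e t. continuous_on {c..d} u \<Longrightarrow> u ` {c..d} \<subseteq> cball Y 1 \<Longrightarrow>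
      continuous_on {c..d} v \<Longrightarrow> v ` {c..d} \<subseteq> cball Y 1 \<Longrightarrow>
      (\<And>r. r \<in> {c..d} \<Longrightarrow> norm (u r - v r) \<le> e) \<Longrightarrow> t \<in> {c..d} \<Longrightarrow>
      norm (integral {c..t} (\<lambda>r. F r (u r)) - integral {c..t} (\<lambda>r. F r (v r))) \<le> e / 2"
  obtains u where "continuous_on {c..d} u" "u ` {c..d} \<subseteq> cball Y 1"
    "\<And>t. t \<in> {c..d} \<Longrightarrow> u t = Y + integral {c..t} (\<lambda>r. F r (u r))"
proof -
  \<comment> \<open>Bounded continuous functions form a complete space as functions on the whole
    line. Clamping the time to \<open>{c..d}\<close> extends the image of the operator constantly
    beyond both ends.\<close>
  define \<kappa> where "\<kappa> t = max c (min d t)" for t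
  have \<kappa>: "\<kappa> t \<in> {c..d}" "t \<in> {c..d} \<Longrightarrow> \<kappa> t = t" for t
    using cd by (auto simp: \<kappa>_def)
  have \<kappa>_cont: "continuous_on UNIV \<kappa>" unfolding \<kappa>_def by (intro continuous_intros)
  define S :: "(real \<Rightarrow>\<^sub>C 'a) set" where "S = PiC UNIV (\<lambda>_. cball Y 1)"
  define Q where "Q u t = Y + integral {c..\<kappa> t} (\<lambda>r. F r (apply_bcontfun u r))" for u t
  have S: "continuous_on {c..d} (apply_bcontfun u)" "apply_bcontfun u ` {c..d} \<subseteq> cball Y 1" if "u \<in> S" for u
    using that by (auto simp: S_def mem_PiC_iff)
  have Q_ball: "Q u t \<in> cball Y 1" if "u \<in> S" for u t
    using bound[OF S[OF that] \<kappa>(1)] by (simp add: Q_def dist_norm)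
  have Q: "Q u \<in> bcontfun" if u: "u \<in> S" for u
  proof -
    have "continuous_on UNIV (\<lambda>t. integral {c..\<kappa> t} (\<lambda>r. F r (apply_bcontfun u r)))"
      by (rule continuous_on_compose2[OF indefinite_integral_continuous_1[OF int[OF S[OF u]]] \<kappa>_cont]) (use \<kappa> in auto)
    then have "continuous_on UNIV (Q u)" unfolding Q_def by (intro continuous_intros)
    moreover have "bounded (range (Q u))"
      by (rule bounded_subset[OF bounded_cball[of Y 1]]) (use Q_ball[OF u] in auto)
    ultimately show ?thesis by (simp add: bcontfun_def)
  qed
  note BQ = Bcontfun_inverse[OF Q]
  have "\<exists>!u\<in>S. Bcontfun (Q u) = u"
  proof (rule Banach_fix[of S "1/2"])
    show "complete S" unfolding S_def complete_eq_closed by (rule closed_PiC) auto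
    have "const_bcontfun Y \<in> S" by (simp add: S_def mem_PiC_iff const_bcontfun.rep_eq)
    then show "S \<noteq> {}" by blast
    show "(\<lambda>u. Bcontfun (Q u)) ` S \<subseteq> S"
      using Q_ball by (auto simp: S_def mem_PiC_iff BQ[unfolded S_def])
    fix u v assume u: "u \<in> S" and v: "v \<in> S"
    show "dist (Bcontfun (Q u)) (Bcontfun (Q v)) \<le> 1/2 * dist u v"
    proof (rule dist_bound)
      fix t
      have "norm (apply_bcontfun u r - apply_bcontfun v r) \<le> dist u v" for r
        using dist_bounded[of u r v] by (simp add: dist_norm)
      then show "dist (apply_bcontfun (Bcontfun (Q u)) t) (apply_bcontfun (Bcontfun (Q v)) t) \<le> 1/2 * dist u v"
        using lipschitz[OF S[OF u] S[OF v] _ \<kappa>(1)[of t], of "dist u v"]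
        by (simp add: BQ[OF u] BQ[OF v] Q_def dist_norm)
    qed
  qed auto
  then obtain u where u: "u \<in> S" "Bcontfun (Q u) = u" by blast
  then have fixpoint: "apply_bcontfun u t = Q u t" for t using BQ[OF u(1)] by simp
  show thesis
  proof (rule that[OF S[OF u(1)]])
    show "apply_bcontfun u t = Y + integral {c..t} (\<lambda>r. F r (apply_bcontfun u r))" if "t \<in> {c..d}" for t
      using fixpoint[of t] unfolding Q_def \<kappa>(2)[OF that] .
  qed
qed

lemma small_integral:
  fixes m :: "real \<Rightarrow> real"
  assumes m: "m integrable_on {c..c + 1}" and e: "0 < e"
  obtains h where "0 < h" "h \<le> 1" "\<And>d. c \<le> d \<Longrightarrow> d \<le> c + h \<Longrightarrow> integral {c..d} m < e"
proof -
  have "continuous (at c within {c..c + 1}) (\<lambda>d. integral {c..d} m)"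
    using indefinite_integral_continuous_1[OF m] by (simp add: continuous_on_eq_continuous_within)
  then obtain h where h: "h > 0" "\<And>d. d \<in> {c..c + 1} \<Longrightarrow> dist d c < h \<Longrightarrow> dist (integral {c..d} m) (integral {c..c} m) < e"
    using e unfolding continuous_within_eps_delta by metis
  show thesis
  proof (rule that[of "min 1 (h / 2)"])
    fix d assume d: "c \<le> d" "d \<le> c + min 1 (h / 2)"
    then have "dist d c < h" using h(1) by (auto simp: dist_real_def)
    moreover have "d \<le> c + 1" using d(2) by simp
    ultimately show "integral {c..d} m < e" using h(2)[of d] d(1) by (auto simp: dist_real_def)
  qed (use h(1) in auto)
qed

text \<open>On a bounded solution the right-hand side is dominated by \<open>m\<close>, so
  increments of \<open>x\<close> are dominated by increments of its primitive \<open>M\<close>,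
  which is uniformly continuous up to \<open>c\<close>. Hence \<open>x\<close> has a limit at
  \<open>c\<close>, and bound and integral equation pass to it by continuity. The ball has radius
  \<open>2 * R\<close> because the pair of present and delayed value is estimated by the sum of
  norms.\<close>

lemma delay_solution_extension_to_endpoint:
  fixes f :: "real \<Rightarrow> 'a \<times> 'a \<Rightarrow> 'a::euclidean_space"
  assumes f: "f \<in> LC p" and p: "1 \<le> p" and sol: "delay_solution f \<phi> (ereal c) x"
    and bound: "\<And>t. -1 \<le> t \<Longrightarrow> t < c \<Longrightarrow> norm (x t) \<le> R"
  obtains y where "continuous_on {-1..c} y" "\<And>t. -1 \<le> t \<Longrightarrow> t < c \<Longrightarrow> y t = x t"
    "\<And>t. t \<in> {-1..c} \<Longrightarrow> norm (y t) \<le> R"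
    "\<And>t. t \<in> {0..c} \<Longrightarrow> y t = x 0 + integral {0..t} (\<lambda>r. f r (y r, y (r - 1)))"
proof -
  have c: "0 < c" using sol by (simp add: delay_solution_def)
  have x_cont: "continuous_on {-1..<c} x"
    using sol unfolding delay_solution_def by (auto elim: continuous_on_subset)
  obtain m l where m0: "\<And>t. 0 \<le> m t" "\<And>t. 0 \<le> l t"
    and m: "\<And>a b. m absolutely_integrable_on {a..b}" "\<And>a b. l absolutely_integrable_on {a..b}"
    "\<And>a b. (\<lambda>t. m t ^ p) absolutely_integrable_on {a..b}"
    "AE t in lborel. \<forall>w\<in>cball 0 (2 * R). norm (f t w) \<le> m t"
    "AE t in lborel. \<forall>z1\<in>cball 0 (2 * R). \<forall>z2\<in>cball 0 (2 * R). norm (f t z1 - f t z2) \<le> l t * norm (z1 - z2)"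
    by (rule LC_boundE[OF f compact_cball p]) (rule that)
  have mi: "m integrable_on {a..b}" for a b by (rule set_lebesgue_integral_eq_integral(1)[OF m(1)])
  define M where "M t = integral {0..t} m" for t
  have incr: "norm (x t - x s) \<le> M t - M s" if st: "0 \<le> s" "s \<le> t" "t < c" for s t
  proof -
    have "norm (x t - x s) \<le> integral {s..t} m"
    proof (rule integral_norm_le_AE[OF delay_solution_has_integral[OF sol st(1,2)] mi])
      show "ereal t < ereal c" using st by simp
      show "AE r in lborel. r \<in> {s..t} \<longrightarrow> norm (f r (x r, x (r - 1))) \<le> m r"
        using m(4)
      proof eventually_elim
        case (elim r)
        have "norm (x r, x (r - 1)) \<le> 2 * R" if "r \<in> {s..t}"
          using norm_Pair_le[of "x r" "x (r - 1)"] bound[of r] bound[of "r - 1"] that st by auto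
        then show ?case using elim by auto
      qed
    qed
    also have "\<dots> = M t - M s"
      using Henstock_Kurzweil_Integration.integral_combine[OF st(1,2) mi] by (simp add: M_def)
    finally show ?thesis .
  qed
  have "uniformly_continuous_on {0..c} M"
    unfolding M_def by (intro compact_uniformly_continuous indefinite_integral_continuous_1 mi) auto
  then have M_uc: "uniformly_continuous_on {0..<c} M"
    unfolding uniformly_continuous_on_def by (metis atLeastAtMost_iff atLeastLessThan_iff less_imp_le)
  have "uniformly_continuous_on {0..<c} x"
    unfolding uniformly_continuous_on_def
  proof (intro allI impI)
    fix e :: real assume "0 < e"
    then obtain d where d: "d > 0" "\<And>s t. s \<in> {0..<c} \<Longrightarrow> t \<in> {0..<c} \<Longrightarrow> dist t s < d \<Longrightarrow> dist (M t) (M s) < e"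
      using M_uc unfolding uniformly_continuous_on_def by meson
    have "dist (x t) (x s) < e" if "s \<in> {0..<c}" "t \<in> {0..<c}" "dist t s < d" for s t
      using incr[of s t] incr[of t s] d(2)[OF that] that
      by (cases "s \<le> t") (auto simp: dist_norm norm_minus_commute)
    then show "\<exists>d>0. \<forall>s\<in>{0..<c}. \<forall>t\<in>{0..<c}. dist t s < d \<longrightarrow> dist (x t) (x s) < e"
      using d(1) by blast
  qed
  then obtain g where g: "uniformly_continuous_on (closure {0..<c}) g" "\<And>t. t \<in> {0..<c} \<Longrightarrow> x t = g t"
    by (rule uniformly_continuous_on_extension_on_closure) (rule that)
  define y where "y t = (if t < c then x t else g c)" for t
  have yx: "y t = x t" if "t < c" for t using that by (simp add: y_def)
  have y_cont: "continuous_on {-1..c} y"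
  proof -
    have "continuous_on {0..c} y"
    proof (rule continuous_on_eq)
      show "continuous_on {0..c} g" using g(1) c by (simp add: uniformly_continuous_imp_continuous)
      show "g t = y t" if "t \<in> {0..c}" for t
        using that g(2)[of t] by (cases "t = c") (auto simp: y_def)
    qed
    moreover have "continuous_on {-1..0} y"
      by (rule continuous_on_eq[OF continuous_on_subset[OF x_cont]]) (use c yx in auto)
    ultimately have "continuous_on ({-1..0} \<union> {0..c}) y" by (intro continuous_on_closed_Un) auto
    also have "{-1..0} \<union> {0..c} = {-1..c}" using c by auto
    finally show ?thesis .
  qed
  have y_bound: "norm (y t) \<le> R" if "t \<in> {-1..c}" for t
    by (rule continuous_on_closure_norm_le[of "{-1..<c}" y]) (use y_cont yx bound that c in auto)
  define G where "G r = f r (y r, y (r - 1))" for r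
  have G: "G integrable_on {0..c}"
    unfolding G_def
    by (rule set_lebesgue_integral_eq_integral(1)[OF LC_comp_integrable(3)[OF f p continuous_on_delay_pair[OF y_cont]]]) simp
  have "continuous_on {0..c} (\<lambda>t. y t - (x 0 + integral {0..t} G))"
    using indefinite_integral_continuous_1[OF G]
    by (intro continuous_intros continuous_on_subset[OF y_cont]) auto
  moreover have "y t - (x 0 + integral {0..t} G) = 0" if t: "t \<in> {0..<c}" for t
  proof -
    have "integral {0..t} G = integral {0..t} (\<lambda>r. f r (x r, x (r - 1)))"
      using t by (intro Henstock_Kurzweil_Integration.integral_cong) (auto simp: G_def yx)
    also have "\<dots> = x t - x 0"
      using delay_solution_has_integral[OF sol, of 0 t] t by (intro integral_unique) auto
    finally show ?thesis using t by (simp add: yx)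
  qed
  ultimately have "norm (y t - (x 0 + integral {0..t} G)) \<le> 0" if "t \<in> {0..c}" for t
    by (intro continuous_on_closure_norm_le[of "{0..<c}" "\<lambda>t. y t - (x 0 + integral {0..t} G)"]) (use that c in auto)
  then have "y t = x 0 + integral {0..t} G" if "t \<in> {0..c}" for t using that by simp
  with y_cont yx y_bound show thesis unfolding G_def by (intro that[of y]) auto
qed

text \<open>After closing the solution up at \<open>c\<close>, a fixed point on a short interval
  \<open>{c..d}\<close> is glued to it. Only the present value is unknown there; the delayed value
  is read off from the part already constructed.\<close>

lemma bounded_delay_solution_extends:
  fixes f :: "real \<Rightarrow> 'a \<times> 'a \<Rightarrow> 'a::euclidean_space"
  assumes f: "f \<in> LC p" and p: "1 \<le> p" and sol: "delay_solution f \<phi> (ereal c) x"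
    and bound: "\<And>t. -1 \<le> t \<Longrightarrow> t < c \<Longrightarrow> norm (x t) \<le> R"
  shows "\<exists>d y. ereal c < d \<and> delay_solution f \<phi> d y \<and> (\<forall>t. -1 \<le> t \<and> ereal t < ereal c \<longrightarrow> y t = x t)"
proof -
  have c: "0 < c" using sol by (simp add: delay_solution_def)
  obtain y where y_cont: "continuous_on {-1..c} y" and yx: "\<And>t. -1 \<le> t \<Longrightarrow> t < c \<Longrightarrow> y t = x t"
    and y_bound: "\<And>t. t \<in> {-1..c} \<Longrightarrow> norm (y t) \<le> R"
    and y_eq: "\<And>t. t \<in> {0..c} \<Longrightarrow> y t = x 0 + integral {0..t} (\<lambda>r. f r (y r, y (r - 1)))"
    by (rule delay_solution_extension_to_endpoint[OF f p sol bound]) (assumption | rule that)+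
  \<comment> \<open>The new piece stays within 1 of \<open>y c\<close>, hence below
    \<open>R + 1\<close>, and the delayed value is at most \<open>R\<close>.\<close>
  let ?K = "cball (0 :: 'a \<times> 'a) (2 * R + 1)"
  obtain m l where m0: "\<And>t. 0 \<le> m t" "\<And>t. 0 \<le> l t"
    and m: "\<And>a b. m absolutely_integrable_on {a..b}" "\<And>a b. l absolutely_integrable_on {a..b}"
    "\<And>a b. (\<lambda>t. m t ^ p) absolutely_integrable_on {a..b}"
    "AE t in lborel. \<forall>w\<in>?K. norm (f t w) \<le> m t"
    "AE t in lborel. \<forall>z1\<in>?K. \<forall>z2\<in>?K. norm (f t z1 - f t z2) \<le> l t * norm (z1 - z2)"
    by (rule LC_boundE[OF f compact_cball p]) (rule that)
  have mi: "m integrable_on {a..b}" "l integrable_on {a..b}" for a b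
    using set_lebesgue_integral_eq_integral(1)[OF m(1)] set_lebesgue_integral_eq_integral(1)[OF m(2)] by auto
  obtain h1 where h1: "0 < h1" "h1 \<le> 1" "\<And>d. c \<le> d \<Longrightarrow> d \<le> c + h1 \<Longrightarrow> integral {c..d} m < 1"
    using small_integral[OF mi(1), of 1 c] by auto
  obtain h2 where h2: "0 < h2" "h2 \<le> 1" "\<And>d. c \<le> d \<Longrightarrow> d \<le> c + h2 \<Longrightarrow> integral {c..d} l < 1/2"
    using small_integral[OF mi(2), of "1/2" c] by auto
  \<comment> \<open>Since \<open>h1\<close> and \<open>h2\<close> are at most 1,
    \<open>r - 1\<close> does not exceed \<open>c\<close> for \<open>r\<close> in
    \<open>{c..d}\<close>, so the delay equation becomes an equation without delay.
    \<open>h1\<close> gives the self-map bound 1, \<open>h2\<close> the contraction factor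
    1/2.\<close>
  define d where "d = c + min h1 h2"
  have d: "c < d" "d \<le> c + 1" using h1 h2 by (auto simp: d_def)
  let ?F = "\<lambda>r v. f r (v, y (r - 1))"
  have ball: "(v, y (r - 1)) \<in> ?K" if "v \<in> cball (y c) 1" "r \<in> {c..d}" for r v
  proof -
    have "norm v \<le> R + 1"
      using that y_bound[of c] c norm_triangle_ineq2[of v "y c"] by (auto simp: dist_norm norm_minus_commute)
    moreover have "norm (y (r - 1)) \<le> R" using that c d by (intro y_bound) auto
    ultimately show ?thesis using norm_Pair_le[of v "y (r - 1)"] by auto
  qed
  have Fi: "(\<lambda>r. ?F r (u r)) integrable_on {c..d}" if u: "continuous_on {c..d} u" for u
  proof -
    have "continuous_on {c..d} (\<lambda>r. (u r, y (r - 1)))"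
      using c d by (intro continuous_intros u continuous_on_compose2[OF y_cont]) auto
    then show ?thesis
      using set_lebesgue_integral_eq_integral(1)[OF LC_comp_integrable(3)[OF f p]] by blast
  qed
  have Fi': "(\<lambda>r. ?F r (u r)) integrable_on {c..t}" if u: "continuous_on {c..d} u" "t \<in> {c..d}" for u t
    by (rule integrable_on_subinterval[OF Fi[OF u(1)]]) (use u(2) in auto)
  obtain u where u: "continuous_on {c..d} u" "u ` {c..d} \<subseteq> cball (y c) 1"
    "\<And>t. t \<in> {c..d} \<Longrightarrow> u t = y c + integral {c..t} (\<lambda>r. ?F r (u r))"
  proof (rule integral_equation_solution[of c d "y c" ?F])
    show "c \<le> d" using d by simp
    fix u assume u: "continuous_on {c..d} u" "u ` {c..d} \<subseteq> cball (y c) 1"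
    show "(\<lambda>r. ?F r (u r)) integrable_on {c..d}" by (rule Fi[OF u(1)])
    have ur: "(u r, y (r - 1)) \<in> ?K" if "r \<in> {c..d}" for r
      using u(2) that by (intro ball) blast+
    show "norm (integral {c..t} (\<lambda>r. ?F r (u r))) \<le> 1" if t: "t \<in> {c..d}" for t
    proof -
      have "norm (integral {c..t} (\<lambda>r. ?F r (u r))) \<le> integral {c..t} m"
      proof (rule integral_norm_le_AE[OF integrable_integral[OF Fi'[OF u(1) t]] mi(1)])
        show "AE r in lborel. r \<in> {c..t} \<longrightarrow> norm (?F r (u r)) \<le> m r"
          using m(4) by eventually_elim (use ur t in auto)
      qed
      also have "\<dots> < 1" using t by (intro h1(3)) (auto simp: d_def)
      finally show ?thesis by simp
    qed
    fix v t and e :: real assume v: "continuous_on {c..d} v" "v ` {c..d} \<subseteq> cball (y c) 1"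
      and e: "\<And>r. r \<in> {c..d} \<Longrightarrow> norm (u r - v r) \<le> e" and t: "t \<in> {c..d}"
    have vr: "(v r, y (r - 1)) \<in> ?K" if "r \<in> {c..d}" for r
      using v(2) that by (intro ball) blast+
    have e0: "0 \<le> e" using e[OF t] norm_ge_zero order_trans by blast
    have "norm (integral {c..t} (\<lambda>r. ?F r (u r)) - integral {c..t} (\<lambda>r. ?F r (v r)))
        \<le> integral {c..t} (\<lambda>r. l r * e)"
    proof (rule integral_norm_le_AE)
      show "((\<lambda>r. ?F r (u r) - ?F r (v r)) has_integral
          integral {c..t} (\<lambda>r. ?F r (u r)) - integral {c..t} (\<lambda>r. ?F r (v r))) {c..t}"
        by (intro has_integral_diff integrable_integral Fi' u v t)
      show "(\<lambda>r. l r * e) integrable_on {c..t}" by (intro integrable_on_mult_left mi)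
      show "AE r in lborel. r \<in> {c..t} \<longrightarrow> norm (?F r (u r) - ?F r (v r)) \<le> l r * e"
        using m(5)
      proof eventually_elim
        case (elim r)
        show ?case
        proof
          assume "r \<in> {c..t}"
          then have r: "r \<in> {c..d}" using t by auto
          have "norm (?F r (u r) - ?F r (v r)) \<le> l r * norm ((u r, y (r - 1)) - (v r, y (r - 1)))"
            using elim ur[OF r] vr[OF r] by blast
          also have "\<dots> \<le> l r * e"
            using e[OF r] m0(2) by (intro mult_left_mono) (auto simp: norm_Pair)
          finally show "norm (?F r (u r) - ?F r (v r)) \<le> l r * e" .
        qed
      qed
    qed
    also have "\<dots> = integral {c..t} l * e" by (rule integral_mult_left)
    also have "\<dots> \<le> 1/2 * e"
    proof (rule mult_right_mono[OF _ e0])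
      have "integral {c..t} l < 1/2" using t by (intro h2(3)) (auto simp: d_def)
      then show "integral {c..t} l \<le> 1/2" by simp
    qed
    finally show "norm (integral {c..t} (\<lambda>r. ?F r (u r)) - integral {c..t} (\<lambda>r. ?F r (v r))) \<le> e / 2" by simp
  qed (rule that)
  define w where "w t = (if t \<le> c then y t else u t)" for t
  have uc: "u c = y c" using u(3)[of c] d by simp
  have wy: "w t = y t" if "t \<le> c" for t using that by (simp add: w_def)
  have wu: "w t = u t" if "c \<le> t" for t using that uc by (cases "t = c") (auto simp: w_def)
  have w_cont: "continuous_on {-1..d} w"
  proof -
    have "continuous_on ({-1..c} \<union> {c..d}) w"
    proof (rule continuous_on_closed_Un)
      show "continuous_on {-1..c} w" by (rule continuous_on_eq[OF y_cont]) (simp add: wy)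
      show "continuous_on {c..d} w" by (rule continuous_on_eq[OF u(1)]) (simp add: wu)
    qed auto
    also have "{-1..c} \<union> {c..d} = {-1..d}" using c d by auto
    finally show ?thesis .
  qed
  let ?G = "\<lambda>r. f r (w r, w (r - 1))"
  have G: "?G integrable_on {0..d}"
    by (rule set_lebesgue_integral_eq_integral(1)[OF LC_comp_integrable(3)[OF f p continuous_on_delay_pair[OF w_cont]]]) simp
  have w_eq: "w t = x 0 + integral {0..t} ?G" if t: "t \<in> {0..d}" for t
  proof (cases "t \<le> c")
    case True
    have "integral {0..t} ?G = integral {0..t} (\<lambda>r. f r (y r, y (r - 1)))"
      using True by (intro Henstock_Kurzweil_Integration.integral_cong) (auto simp: wy)
    then show ?thesis using True t y_eq[of t] by (simp add: wy)
  next
    case False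
    have "integral {0..t} ?G = integral {0..c} ?G + integral {c..t} ?G"
      using Henstock_Kurzweil_Integration.integral_combine[of 0 c t ?G] c False t
        integrable_on_subinterval[OF G, of 0 t] by simp
    also have "integral {0..c} ?G = integral {0..c} (\<lambda>r. f r (y r, y (r - 1)))"
      by (intro Henstock_Kurzweil_Integration.integral_cong) (auto simp: wy)
    also have "integral {c..t} ?G = integral {c..t} (\<lambda>r. ?F r (u r))"
      using t d by (intro Henstock_Kurzweil_Integration.integral_cong) (auto simp: wu wy)
    finally show ?thesis using u(3)[of t] y_eq[of c] wu[of t] False t c by simp
  qed
  have init: "w t = \<phi> t" if "t \<in> {-1..0}" for t
    using that c yx[of t] sol by (auto simp: wy delay_solution_def)
  have "delay_solution f \<phi> (ereal d) w"
    using delay_solution_of_integral[OF f p _ w_cont init w_eq] c d by simp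
  moreover have "w t = x t" if "-1 \<le> t" "t < c" for t using that yx by (simp add: wy)
  ultimately show ?thesis using d by (intro exI[of _ "ereal d"] exI[of _ w]) auto
qed

section \<open>Continuous dependence\<close>

text \<open>
  The kernel \<open>d\<Lambda>\<close> is only integrable. Instead of comparing with an exponential, the bound is
  doubled each time \<open>\<Lambda>\<close> increases by \<open>1/2\<close>.
\<close>

lemma stepwise_gronwall:
  fixes w \<Lambda> :: "real \<Rightarrow> real"
  assumes w: "continuous_on {-1..T} w" "\<And>r. 0 \<le> w r" and \<eta>: "0 \<le> \<eta>"
    and init: "\<And>r. r \<in> {-1..0} \<Longrightarrow> w r \<le> \<delta>"
    and \<Lambda>: "continuous_on {0..T} \<Lambda>" "\<Lambda> 0 = 0"
    and mono: "\<And>s t. 0 \<le> s \<Longrightarrow> s \<le> t \<Longrightarrow> t \<le> T \<Longrightarrow> \<Lambda> s \<le> \<Lambda> t"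
    and step: "\<And>s t B. 0 \<le> s \<Longrightarrow> s \<le> t \<Longrightarrow> t \<le> T \<Longrightarrow> (\<And>r. r \<in> {-1..t} \<Longrightarrow> w r \<le> B) \<Longrightarrow>
      w t \<le> w s + \<eta> + (\<Lambda> t - \<Lambda> s) * B"
    and t: "t \<in> {0..T}" "\<Lambda> t \<le> real k / 2" and r: "r \<in> {-1..t}"
  shows "w r + 2 * \<eta> \<le> 2 ^ Suc k * (\<delta> + 2 * \<eta>)"
proof -
  have double: "w r \<le> 2 * C + 2 * \<eta>"
    if st: "0 \<le> s" "s \<le> t" "t \<le> T" "\<Lambda> t - \<Lambda> s \<le> 1/2" and C: "\<And>r. r \<in> {-1..s} \<Longrightarrow> w r \<le> C"
      and r: "r \<in> {-1..t}" for s t C r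
  proof -
    \<comment> \<open>The maximum is taken over the whole history from -1, which takes care of the
      delay. At a maximum point beyond \<open>s\<close> the growth inequality gives
      \<open>w \<rho> \<le> C + \<eta> + w \<rho> / 2\<close>, and the last term is absorbed on the
      left.\<close>
    have "\<exists>\<rho>\<in>{-1..t}. \<forall>r\<in>{-1..t}. w r \<le> w \<rho>"
      using st by (intro continuous_attains_sup continuous_on_subset[OF w(1)]) auto
    then obtain \<rho> where \<rho>: "\<rho> \<in> {-1..t}" "\<And>r. r \<in> {-1..t} \<Longrightarrow> w r \<le> w \<rho>" by blast
    have "0 \<le> C" using w(2)[of "-1"] C[of "-1"] st by simp
    have "w \<rho> \<le> 2 * C + 2 * \<eta>"
    proof (cases "\<rho> \<le> s")
      case True
      then show ?thesis using C[of \<rho>] \<rho>(1) \<open>0 \<le> C\<close> \<eta> by simp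
    next
      case False
      then have "w \<rho> \<le> w s + \<eta> + (\<Lambda> \<rho> - \<Lambda> s) * w \<rho>"
        using \<rho> st by (intro step) auto
      also have "\<dots> \<le> C + \<eta> + 1/2 * w \<rho>"
      proof (intro add_mono mult_right_mono w(2))
        show "w s \<le> C" using C[of s] st by simp
        show "\<Lambda> \<rho> - \<Lambda> s \<le> 1/2" using mono[of \<rho> t] False \<rho> st by auto
      qed simp
      finally show ?thesis by simp
    qed
    then show ?thesis using \<rho>(2)[OF r] by simp
  qed
  show ?thesis using t r
  proof (induction k arbitrary: t r)
    case 0
    then have "w r \<le> 2 * \<delta> + 2 * \<eta>"
      using init \<Lambda>(2) by (intro double[of 0 t]) auto
    then show ?case by simp
  next
    case (Suc k)
    show ?case
    proof (cases "\<Lambda> t \<le> real k / 2")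
      case True
      have "0 \<le> \<delta>" using w(2)[of 0] init[of 0] by simp
      then have le: "2 ^ Suc k * (\<delta> + 2 * \<eta>) \<le> 2 ^ Suc (Suc k) * (\<delta> + 2 * \<eta>)"
        using \<eta> by (intro mult_right_mono power_increasing) auto
      show ?thesis by (rule order_trans[OF Suc.IH[OF Suc.prems(1) True Suc.prems(3)] le])
    next
      case False
      have "\<exists>s\<ge>0. s \<le> t \<and> \<Lambda> s = real k / 2"
        using False Suc.prems(1) \<Lambda> by (intro IVT') (auto intro: continuous_on_subset)
      then obtain s where s: "0 \<le> s" "s \<le> t" "\<Lambda> s = real k / 2" by blast
      \<comment> \<open>One step sends a bound \<open>C\<close> to
        \<open>2 * C + 2 * \<eta>\<close>, so the quantity that exactly doubles is the bound plus
        \<open>2 * \<eta>\<close>; this explains the shape of the conclusion.\<close>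
      have "w r \<le> 2 * (2 ^ Suc k * (\<delta> + 2 * \<eta>) - 2 * \<eta>) + 2 * \<eta>"
      proof (rule double[OF s(1,2)])
        show "\<Lambda> t - \<Lambda> s \<le> 1/2" using Suc.prems(2) s(3) by simp
        fix r assume "r \<in> {-1..s}"
        then show "w r \<le> 2 ^ Suc k * (\<delta> + 2 * \<eta>) - 2 * \<eta>"
          using Suc.IH[of s r] s Suc.prems(1) by auto
      qed (use Suc.prems in auto)
      then show ?thesis by simp
    qed
  qed
qed

text \<open>Only the Lipschitz function of \<open>f\<close> enters, so the number \<open>k\<close>
  of doublings is independent of \<open>g\<close>. The perturbation \<open>g - f\<close> is measured
  along the curve of \<open>y\<close>, which is merely known to lie in the ball.\<close>

lemma delay_solution_close:
  fixes f g :: "real \<Rightarrow> 'a \<times> 'a \<Rightarrow> 'a::euclidean_space"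
  assumes f: "f \<in> LC p" and g: "g \<in> LC p" and p: "1 \<le> p"
    and x: "delay_solution f \<phi> b x" "ereal \<tau> < b" and y: "delay_solution g \<psi> c y" "ereal \<tau> < c"
    and \<tau>: "0 \<le> \<tau>" "\<tau> \<le> q"
    and x_bound: "\<And>t. t \<in> {-1..\<tau>} \<Longrightarrow> norm (x t) \<le> R"
    and y_bound: "\<And>t. t \<in> {-1..\<tau>} \<Longrightarrow> norm (y t) \<le> R"
    and l: "\<And>a b. l integrable_on {a..b}" "\<And>t. 0 \<le> l t"
      "AE t in lborel. \<forall>z1\<in>cball 0 (2 * R). \<forall>z2\<in>cball 0 (2 * R).
        norm (f t z1 - f t z2) \<le> l t * norm (z1 - z2)"
    and pert: "\<And>z. continuous_on {0..q} z \<Longrightarrow> z ` {0..q} \<subseteq> cball 0 (2 * R) \<Longrightarrow>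
      integral {0..q} (\<lambda>t. norm (g t (z t) - f t (z t))) \<le> \<eta>"
    and init: "\<And>t. t \<in> {-1..0} \<Longrightarrow> norm (\<psi> t - \<phi> t) \<le> \<delta>"
    and k: "2 * integral {0..\<tau>} l \<le> real k / 2"
    and r: "r \<in> {-1..\<tau>}"
  shows "norm (y r - x r) + 2 * \<eta> \<le> 2 ^ Suc k * (\<delta> + 2 * \<eta>)"
proof (rule stepwise_gronwall[where w = "\<lambda>r. norm (y r - x r)" and \<Lambda> = "\<lambda>t. 2 * integral {0..t} l" and t = \<tau> and T = \<tau>])
  have x_cont: "continuous_on {-1..\<tau>} x"
  proof (rule continuous_on_subset)
    show "continuous_on {t. -1 \<le> t \<and> ereal t < b} x" using x(1) by (simp add: delay_solution_def)
    show "{-1..\<tau>} \<subseteq> {t. -1 \<le> t \<and> ereal t < b}" by (auto intro!: le_less_trans[OF _ x(2)])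
  qed
  have y_cont: "continuous_on {-1..\<tau>} y"
  proof (rule continuous_on_subset)
    show "continuous_on {t. -1 \<le> t \<and> ereal t < c} y" using y(1) by (simp add: delay_solution_def)
    show "{-1..\<tau>} \<subseteq> {t. -1 \<le> t \<and> ereal t < c}" by (auto intro!: le_less_trans[OF _ y(2)])
  qed
  show "continuous_on {-1..\<tau>} (\<lambda>r. norm (y r - x r))" by (intro continuous_intros x_cont y_cont)
  have R: "0 \<le> R" using x_bound[of 0] \<tau> norm_ge_zero order_trans by (metis atLeastAtMost_iff le_minus_one_simps(1) order.trans)
  have "0 \<le> integral {0..q} (\<lambda>t. norm (g t 0 - f t 0))"
    by (rule Henstock_Kurzweil_Integration.integral_nonneg)
       (use LC_comp_integrable(3)[OF LC_diff[OF g f] p continuous_on_const[of "{0..q}" 0]] in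
         \<open>auto simp: absolutely_integrable_on_def\<close>)
  also have "\<dots> \<le> \<eta>" using R by (intro pert) auto
  finally show "0 \<le> \<eta>" .
  show "norm (y r - x r) \<le> \<delta>" if "r \<in> {-1..0}" for r
    using init[OF that] x(1) y(1) that by (simp add: delay_solution_def)
  show "continuous_on {0..\<tau>} (\<lambda>t. 2 * integral {0..t} l)"
    by (intro continuous_intros indefinite_integral_continuous_1 l)
  have split: "integral {0..t} l - integral {0..s} l = integral {s..t} l" if "0 \<le> s" "s \<le> t" for s t
    using Henstock_Kurzweil_Integration.integral_combine[OF that l(1)] by simp
  show "2 * integral {0..s} l \<le> 2 * integral {0..t} l" if "0 \<le> s" "s \<le> t" for s t
    using split[OF that] Henstock_Kurzweil_Integration.integral_nonneg[OF l(1), of s t] l(2) by simp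
  let ?zx = "\<lambda>r. (x r, x (r - 1))" and ?zy = "\<lambda>r. (y r, y (r - 1))"
  \<comment> \<open>The hypothesis on the perturbation concerns the fixed interval
    \<open>{0..q}\<close>, whereas the curve is known up to \<open>\<tau>\<close> only. Freezing it
    at \<open>\<tau>\<close> keeps it continuous and inside the ball.\<close>
  define z where "z r = ?zy (min r \<tau>)" for r
  have z_cont: "continuous_on {0..q} z"
    unfolding z_def using \<tau>
    by (auto intro!: continuous_intros continuous_on_compose2[OF y_cont])
  have z_ball: "?zx r \<in> cball 0 (2 * R)" "?zy r \<in> cball 0 (2 * R)" if "r \<in> {0..\<tau>}" for r
    using norm_Pair_le[of "x r" "x (r - 1)"] norm_Pair_le[of "y r" "y (r - 1)"] that
      x_bound[of r] x_bound[of "r - 1"] y_bound[of r] y_bound[of "r - 1"] by auto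
  have "z ` {0..q} \<subseteq> cball 0 (2 * R)"
    unfolding z_def using z_ball(2) \<tau> by (intro image_subsetI) (simp add: min_def)
  note z_pert = pert[OF z_cont this]
  let ?d = "\<lambda>r. norm (g r (?zy r) - f r (?zy r))"
  have d_int: "(\<lambda>r. norm (g r (z r) - f r (z r))) integrable_on {0..q}"
    using LC_comp_integrable(3)[OF LC_diff[OF g f] p z_cont] by (simp add: absolutely_integrable_on_def)
  fix s t B assume st: "0 \<le> s" "s \<le> t" "t \<le> \<tau>" and B: "\<And>r. r \<in> {-1..t} \<Longrightarrow> norm (y r - x r) \<le> B"
  have zy: "z r = ?zy r" if "r \<in> {s..t}" for r using that st by (simp add: z_def)
  have d_int': "(\<lambda>r. norm (g r (z r) - f r (z r))) integrable_on {s..t}"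
    by (rule integrable_on_subinterval[OF d_int]) (use st \<tau> in auto)
  then have di: "?d integrable_on {s..t}"
    by (rule integrable_eq) (simp add: zy)
  have "integral {s..t} ?d = integral {s..t} (\<lambda>r. norm (g r (z r) - f r (z r)))"
    by (rule Henstock_Kurzweil_Integration.integral_cong) (simp add: zy)
  also have "\<dots> \<le> integral {0..q} (\<lambda>r. norm (g r (z r) - f r (z r)))"
    using st \<tau> by (intro integral_subset_le d_int d_int') auto
  finally have d_le: "integral {s..t} ?d \<le> \<eta>" using z_pert by simp
  have "ereal t < b" "ereal t < c" using st(3) by (auto intro!: le_less_trans[OF _ x(2)] le_less_trans[OF _ y(2)])
  then have diff: "((\<lambda>r. g r (?zy r) - f r (?zx r)) has_integral (y t - y s) - (x t - x s)) {s..t}"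
    using delay_solution_has_integral[OF x(1) st(1,2)] delay_solution_has_integral[OF y(1) st(1,2)]
    by (intro has_integral_diff) auto
  have "norm ((y t - y s) - (x t - x s)) \<le> integral {s..t} (\<lambda>r. ?d r + l r * (2 * B))"
  proof (rule integral_norm_le_AE[OF diff])
    show "(\<lambda>r. ?d r + l r * (2 * B)) integrable_on {s..t}"
      by (intro integrable_add di integrable_on_mult_left l)
    show "AE r in lborel. r \<in> {s..t} \<longrightarrow> norm (g r (?zy r) - f r (?zx r)) \<le> ?d r + l r * (2 * B)"
      using l(3)
    proof eventually_elim
      case (elim r)
      show ?case
      proof
        assume r: "r \<in> {s..t}"
        have "r \<in> {0..\<tau>}" using r st by simp
        then have zz: "norm (f r (?zy r) - f r (?zx r)) \<le> l r * norm (?zy r - ?zx r)"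
          using elim z_ball by blast
        \<comment> \<open>Present and delayed difference are each at most \<open>B\<close>; this is
          the origin of the factor 2 in the choice of \<open>\<Lambda>\<close>.\<close>
        have "norm (?zy r - ?zx r) \<le> 2 * B"
          using norm_Pair_le[of "y r - x r" "y (r - 1) - x (r - 1)"] B[of r] B[of "r - 1"] r st by simp
        then have "norm (f r (?zy r) - f r (?zx r)) \<le> l r * (2 * B)"
          using mult_left_mono[OF _ l(2)[of r]] zz order_trans by blast
        then show "norm (g r (?zy r) - f r (?zx r)) \<le> ?d r + l r * (2 * B)"
          using norm_triangle_ineq[of "g r (?zy r) - f r (?zy r)" "f r (?zy r) - f r (?zx r)"] by simp
      qed
    qed
  qed
  also have "\<dots> = integral {s..t} ?d + integral {s..t} (\<lambda>r. l r * (2 * B))"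
    by (intro Henstock_Kurzweil_Integration.integral_add di integrable_on_mult_left l)
  also have "\<dots> \<le> \<eta> + (2 * integral {0..t} l - 2 * integral {0..s} l) * B"
    using d_le split[OF st(1,2)] by (simp add: algebra_simps)
  finally have "norm ((y t - x t) - (y s - x s)) \<le> \<eta> + (2 * integral {0..t} l - 2 * integral {0..s} l) * B"
    by (simp add: algebra_simps)
  then show "norm (y t - x t) \<le> norm (y s - x s) + \<eta> + (2 * integral {0..t} l - 2 * integral {0..s} l) * B"
    using norm_triangle_ineq2[of "y t - x t" "y s - x s"] by simp
qed (use \<tau> k r in auto)

theorem theorem3p4:
  fixes p :: nat
    and f :: "real \<Rightarrow> (real ^ 'n) \<times> (real ^ 'n) \<Rightarrow> real ^ 'n"
    and fs :: "nat \<Rightarrow> real \<Rightarrow> (real ^ 'n) \<times> (real ^ 'n) \<Rightarrow> real ^ 'n"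
    and \<phi> :: "real \<Rightarrow> real ^ 'n"
    and \<phi>s :: "nat \<Rightarrow> real \<Rightarrow> real ^ 'n"
    and x :: "real \<Rightarrow> real ^ 'n"
    and xs :: "nat \<Rightarrow> real \<Rightarrow> real ^ 'n"
    and b :: ereal
    and bs :: "nat \<Rightarrow> ereal"
  assumes "p \<ge> 1"
    and "\<And>n. fs n \<in> LC p"
    and "f \<in> LC p"
    and "limitin (TB p) fs f sequentially"
    and "\<And>n. continuous_on {-1..0} (\<phi>s n)"
    and "continuous_on {-1..0} \<phi>"
    and "uniform_limit {-1..0} \<phi>s \<phi> sequentially"
    and "\<And>n. maximal_delay_solution (fs n) (\<phi>s n) (bs n) (xs n)"
    and "maximal_delay_solution f \<phi> b x"
  shows "\<forall>T. -1 \<le> T \<and> ereal T < b \<longrightarrow>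
           (\<forall>\<^sub>F n in sequentially. ereal T < bs n) \<and>
           uniform_limit {-1..T} xs x sequentially"
proof (intro allI impI)
  fix T assume T: "-1 \<le> T \<and> ereal T < b"
  have sol: "delay_solution f \<phi> b x" using assms(9) by (simp add: maximal_delay_solution_def)
  have sols: "delay_solution (fs n) (\<phi>s n) (bs n) (xs n)" for n
    using assms(8) by (simp add: maximal_delay_solution_def)
  \<comment> \<open>\<open>T\<close> may be negative, while the integral equations start at
    0.\<close>
  define S where "S = max T 0"
  have S: "0 \<le> S" "T \<le> S" "ereal S < b"
    using T sol by (auto simp: S_def max_def delay_solution_def zero_ereal_def)
  have close: "\<forall>\<^sub>F n in sequentially. ereal S < bs n \<and> (\<forall>r\<in>{-1..S}. dist (xs n r) (x r) < e)"
    if "0 < e" for e :: real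
  proof -
    \<comment> \<open>The cap 1 makes the final estimate strictly better than the width of the tube,
      as the first-exit argument requires.\<close>
    define \<epsilon> where "\<epsilon> = min e 1"
    have \<epsilon>: "0 < \<epsilon>" "\<epsilon> \<le> 1" "\<epsilon> \<le> e" using that by (auto simp: \<epsilon>_def)
    have x_cont: "continuous_on {-1..S} x"
    proof (rule continuous_on_subset)
      show "continuous_on {t. -1 \<le> t \<and> ereal t < b} x" using sol by (simp add: delay_solution_def)
      show "{-1..S} \<subseteq> {t. -1 \<le> t \<and> ereal t < b}" by (auto intro!: le_less_trans[OF _ S(3)])
    qed
    have "bounded (x ` {-1..S})"
      by (rule compact_imp_bounded[OF compact_continuous_image[OF x_cont compact_Icc]])
    then obtain R0 where "\<forall>y\<in>x ` {-1..S}. norm y \<le> R0" unfolding bounded_iff by blast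
    then have R0: "norm (x t) \<le> R0" if "t \<in> {-1..S}" for t using that by blast
    \<comment> \<open>Seminorms are indexed by integer radii. \<open>R = j / 2\<close> bounds
      everything in the tube of width 1, and \<open>2 * R = j\<close> bounds the pairs. Likewise
      \<open>q\<close> is a natural number so that the interval has rational endpoints.\<close>
    obtain j where j: "2 * (R0 + 1) \<le> real j" using real_arch_simple by blast
    define R where "R = real j / 2"
    have R: "R0 + 1 \<le> R" "2 * R = real j" using j by (auto simp: R_def)
    obtain q where q: "S \<le> real q" using real_arch_simple by blast
    obtain m l where m0: "\<And>t. 0 \<le> m t" "\<And>t. 0 \<le> l t"
      and m: "\<And>a b. m absolutely_integrable_on {a..b}" "\<And>a b. l absolutely_integrable_on {a..b}"
      "\<And>a b. (\<lambda>t. m t ^ p) absolutely_integrable_on {a..b}"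
      "AE t in lborel. \<forall>w\<in>cball 0 (2 * R). norm (f t w) \<le> m t"
      "AE t in lborel. \<forall>z1\<in>cball 0 (2 * R). \<forall>z2\<in>cball 0 (2 * R). norm (f t z1 - f t z2) \<le> l t * norm (z1 - z2)"
      by (rule LC_boundE[OF assms(3) compact_cball assms(1)]) (rule that)
    have li: "l integrable_on {a..b}" for a b
      by (rule set_lebesgue_integral_eq_integral(1)[OF m(2)])
    obtain k :: nat where k: "4 * integral {0..S} l \<le> real k" using real_arch_simple by blast
    \<comment> \<open>One constant serves as bound for the initial data and for the perturbation
      integral: \<open>2 ^ Suc k * (c + 2 * c)\<close> equals three quarters of
      \<open>\<epsilon>\<close>. It is chosen before \<open>n\<close>.\<close>
    define c where "c = \<epsilon> / (4 * 2 ^ Suc k)"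
    have c: "0 < c" "c < 1" "2 ^ Suc k * (c + 2 * c) < \<epsilon>"
    proof -
      show "0 < c" using \<epsilon> by (simp add: c_def)
      show "2 ^ Suc k * (c + 2 * c) < \<epsilon>" using \<epsilon> by (simp add: c_def)
      have "1 \<le> (2::real) ^ Suc k" by (rule one_le_power) simp
      then have "\<epsilon> < 4 * 2 ^ Suc k" using \<epsilon> by linarith
      then show "c < 1" by (simp add: c_def)
    qed
    have ev1: "\<forall>\<^sub>F n in sequentially. \<forall>t\<in>{-1..0}. dist (\<phi>s n t) (\<phi> t) < c"
      by (rule uniform_limitD[OF assms(7) c(1)])
    have ev2: "\<forall>\<^sub>F n in sequentially. \<forall>z. continuous_on {0..real q} z \<longrightarrow> z ` {0..real q} \<subseteq> cball 0 (real j) \<longrightarrow>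
      integral {0..real q} (\<lambda>t. norm (fs n t (z t) - f t (z t))) < c"
      by (rule TB_limit_integral[OF assms(4,1,3,2) _ _ _ c(1)]) auto
    show ?thesis
      using ev1 ev2
    proof eventually_elim
      case (elim n)
      have init: "norm (\<phi>s n t - \<phi> t) < c" if "t \<in> {-1..0}" for t
        using elim(1) that by (simp add: dist_norm)
      let ?w = "\<lambda>r. norm (xs n r - x r)"
      have improve: "?w r < \<epsilon>"
        if \<tau>: "\<tau> \<in> {0..S}" "ereal \<tau> < bs n" and le1: "\<And>r. r \<in> {-1..\<tau>} \<Longrightarrow> ?w r \<le> 1" and r: "r \<in> {-1..\<tau>}" for \<tau> r
      proof -
        have "?w r + 2 * c \<le> 2 ^ Suc k * (c + 2 * c)"
        proof (rule delay_solution_close[OF assms(3,2,1) sol _ sols \<tau>(2) _ _ _ _ li m0(2) m(5) _ _ _ r])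
          show "ereal \<tau> < b" using \<tau>(1) by (auto intro!: le_less_trans[OF _ S(3)])
          show "0 \<le> \<tau>" "\<tau> \<le> real q" using \<tau>(1) q by auto
          show "norm (x t) \<le> R" if "t \<in> {-1..\<tau>}" for t using R0[of t] that \<tau>(1) R(1) by auto
          show "norm (xs n t) \<le> R" if "t \<in> {-1..\<tau>}" for t
            using R0[of t] le1[OF that] that \<tau>(1) R(1) norm_triangle_ineq2[of "xs n t" "x t"] by auto
          show "norm (\<phi>s n t - \<phi> t) \<le> c" if "t \<in> {-1..0}" for t using init[OF that] by simp
          show "integral {0..real q} (\<lambda>t. norm (fs n t (z t) - f t (z t))) \<le> c"
            if "continuous_on {0..real q} z" "z ` {0..real q} \<subseteq> cball 0 (2 * R)" for z
            using elim(2) that unfolding R(2) by (simp add: less_imp_le)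
          have "integral {0..\<tau>} l \<le> integral {0..S} l"
            using \<tau>(1) m0(2) by (intro integral_subset_le li) auto
          then show "2 * integral {0..\<tau>} l \<le> real k / 2" using k by simp
        qed
        then show ?thesis using c by simp
      qed
      \<comment> \<open>First-exit argument: at the least time \<open>s\<close> with distance at
        least 1, continuity gives distance at most 1 on all of \<open>{-1..s}\<close>, so
        \<open>improve\<close> applies there and yields distance below
        \<open>\<epsilon> \<le> 1\<close> at \<open>s\<close>. The initial data are closer than
        \<open>c < 1\<close>, which forces \<open>s\<close> to be positive.\<close>
      have near: "?w r \<le> 1" if \<tau>: "\<tau> \<in> {0..S}" "ereal \<tau> < bs n" and r: "r \<in> {-1..\<tau>}" for \<tau> r
      proof (rule ccontr)
        assume far: "\<not> ?w r \<le> 1"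
        have xs_cont: "continuous_on {-1..\<tau>} (xs n)"
        proof (rule continuous_on_subset)
          show "continuous_on {t. -1 \<le> t \<and> ereal t < bs n} (xs n)" using sols by (simp add: delay_solution_def)
          show "{-1..\<tau>} \<subseteq> {t. -1 \<le> t \<and> ereal t < bs n}" by (auto intro!: le_less_trans[OF _ \<tau>(2)])
        qed
        have d_cont: "continuous_on {-1..\<tau>} (\<lambda>r. xs n r - x r)"
          by (intro continuous_intros xs_cont continuous_on_subset[OF x_cont]) (use \<tau> in auto)
        define X where "X = {r \<in> {-1..\<tau>}. 1 \<le> ?w r}"
        have "closed X"
          unfolding X_def by (intro continuous_on_closed_Collect_le closed_atLeastAtMost continuous_intros d_cont)
        moreover have "bounded X"
          by (rule bounded_subset[of "{-1..\<tau>}"]) (auto simp: X_def)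
        ultimately have "compact X" by (simp add: compact_eq_bounded_closed)
        moreover have "X \<noteq> {}" using far r by (force simp: X_def)
        ultimately obtain s where s: "s \<in> X" "\<And>t. t \<in> X \<Longrightarrow> s \<le> t" using compact_attains_inf by metis
        have s_range: "s \<in> {-1..\<tau>}" "1 \<le> ?w s" using s(1) by (auto simp: X_def)
        have "0 < s"
        proof (rule ccontr)
          assume "\<not> 0 < s"
          then have "s \<in> {-1..0}" using s_range by simp
          then have "?w s < c" using init[of s] sol sols[of n] by (simp add: delay_solution_def)
          then show False using s_range c by simp
        qed
        have before: "?w t \<le> 1" if "t \<in> {-1..<s}" for t
          using s(2)[of t] that s_range by (force simp: X_def)
        have "?w t \<le> 1" if "t \<in> {-1..s}" for t
          by (rule continuous_on_closure_norm_le[of "{-1..<s}" "\<lambda>r. xs n r - x r"])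
             (use \<open>0 < s\<close> s_range before that continuous_on_subset[OF d_cont, of "{-1..s}"] in auto)
        moreover have "ereal s < bs n" using s_range by (auto intro!: le_less_trans[OF _ \<tau>(2)])
        ultimately have "?w s < \<epsilon>" using \<open>0 < s\<close> s_range \<tau>(1) by (intro improve[of s]) auto
        then show False using s_range \<epsilon> by simp
      qed
      \<comment> \<open>Otherwise \<open>xs n\<close> would end at a finite time
        \<open>d \<le> S\<close>. Up to that time it stays in the tube, hence is bounded by
        \<open>R\<close>, and it could be continued, against its maximality.\<close>
      have "ereal S < bs n"
      proof (rule ccontr)
        assume "\<not> ereal S < bs n"
        moreover have "0 < bs n" using sols by (simp add: delay_solution_def)
        ultimately obtain d where d: "bs n = ereal d" "0 < d" "d \<le> S" by (cases "bs n") auto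
        have "norm (xs n t) \<le> R" if t: "-1 \<le> t" "t < d" for t
        proof -
          \<comment> \<open>The tube estimate is indexed by end times in \<open>{0..S}\<close>; for
            \<open>t\<close> in the initial interval the end time 0 is used.\<close>
          have "?w t \<le> 1" using t d by (intro near[of "max t 0"]) auto
          then show ?thesis
            using R0[of t] t d R(1) norm_triangle_ineq2[of "xs n t" "x t"] by auto
        qed
        then have "\<exists>c y. ereal d < c \<and> delay_solution (fs n) (\<phi>s n) c y \<and>
            (\<forall>t. -1 \<le> t \<and> ereal t < ereal d \<longrightarrow> y t = xs n t)"
          using sols[of n] unfolding d(1) by (intro bounded_delay_solution_extends[OF assms(2,1)])
        then show False using assms(8)[of n] unfolding maximal_delay_solution_def d(1) by blast
      qed
      moreover have "dist (xs n r) (x r) < e" if "r \<in> {-1..S}" for r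
      proof -
        have "?w r < \<epsilon>" using improve[of S r] near[of S] calculation S(1) that by auto
        then show ?thesis using \<epsilon>(3) by (simp add: dist_norm)
      qed
      ultimately show ?case by blast
    qed
  qed
  show "(\<forall>\<^sub>F n in sequentially. ereal T < bs n) \<and> uniform_limit {-1..T} xs x sequentially"
  proof
    show "\<forall>\<^sub>F n in sequentially. ereal T < bs n"
      using close[OF zero_less_one]
    proof eventually_elim
      case (elim n)
      then show ?case using S(2) by (auto intro: le_less_trans[of _ "ereal S"])
    qed
    show "uniform_limit {-1..T} xs x sequentially"
    proof (rule uniform_limitI)
      fix e :: real assume "0 < e"
      from close[OF this] show "\<forall>\<^sub>F n in sequentially. \<forall>r\<in>{-1..T}. dist (xs n r) (x r) < e"
        by eventually_elim (use S(2) in auto)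
    qed
  qed
qed

end
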